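(* Let $n\ge 2$, let $\mathcal{T}^n=\{0=x_0<x_1<\dots<x_n<x_{n+1}=1\}$, and let $\hat s_1\in(x_n,1)$ be such that $a(\phi_{\hat s_1},\widetilde\phi_n)=0$, where $\widetilde\phi_n$ and $\phi_{\hat s_1}$ are the nodal basis (hat) functions at $x_n$ and at $\hat s_1$ for the grid $\hat{\mathcal{T}}^{n+1}=\{x_0<x_1<\dots<x_n<\hat s_1<x_{n+1}\}$. Let $u$ be the solution of $$-\varepsilon u''-bu'+cu=f \ \text{ on } [0,1],\qquad u(0)=u(1)=0,$$ and let $\hat u^{n+1}$ be its finite element solution on $\hat{\mathcal{T}}^{n+1}$. Let $w$ be the solution of $$-\varepsilon w''-bw'+cw=f\ \text{ on } [0,\hat s_1],\qquad w(0)=0,\quad w(\hat s_1)=u(\hat s_1),$$ and let $w^n$ be its finite element solution on the grid $\hat{\mathcal{T}}^{n+1}\setminus\{1\}=\{x_0<x_1<\dots<x_n<\hat s_1\}$. Then $$w(x)=u(x)\quad\text{for all } x\in[0,\hat s_1],$$ and $$\hat u^{n+1}(x)=w^n(x)\quad\text{for all } x\in[0,x_n].$$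
   Context: Here $\varepsilon>0$, $b\le 0$, $c\ge 0$ are real constants with $b,c$ not both zero, and $f\in L^2(0,1)$. Solutions are understood in the weak sense. Let $(\cdot,\cdot)$ be the $L^2(0,1)$ inner product and $a(u,v)=\varepsilon(u',v')+b(u,v')+c(u,v)$ for $u,v\in H^1(0,1)$; $u\in H_0^1(0,1)$ is the weak solution of the first problem if $a(u,v)=(f,v)$ for all $v\in H_0^1(0,1)$. Similarly $w\in H^1(0,\hat s_1)$ with the prescribed boundary values is the weak solution of the second problem if the same identity, with all integrals taken over $(0,\hat s_1)$, holds for all $v\in H_0^1(0,\hat s_1)$. For a grid of an interval, the nodal basis (hat) function at an interior node is the continuous function that is affine between consecutive nodes, equal to $1$ at that node and $0$ at all other nodes. The finite element solution $\hat u^{n+1}$ is the unique continuous function on $[0,1]$, affine between consecutive nodes of $\hat{\mathcal{T}}^{n+1}$ and vanishing at $0$ and $1$, with $a(\hat u^{n+1},v)=(f,v)$ for all $v$ of the same kind. The finite element solution $w^n$ is the unique continuous function on $[0,\hat s_1]$, affine between consecutive nodes of $\{x_0,\dots,x_n,\hat s_1\}$, with $w^n(0)=0$ and $w^n(\hat s_1)=u(\hat s_1)$, satisfying $\varepsilon(w^{n\prime},v')+b(w^n,v')+c(w^n,v)=(f,v)$ (integrals over $(0,\hat s_1)$) for all continuous $v$ that are affine between consecutive nodes and vanish at $0$ and $\hat s_1$. *)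

theory Defs
  imports "HOL-Analysis.Analysis"
begin

(* Functions on an interval are total functions real => real; except for test functions,
   which are extended by zero, their values outside the interval are irrelevant. *)

definition L2 :: "real \<Rightarrow> real \<Rightarrow> (real \<Rightarrow> real) set" where
  "L2 l r = {f. set_borel_measurable lebesgue {l<..<r} f \<and>
                set_integrable lebesgue {l<..<r} (\<lambda>x. (f x)\<^sup>2)}"

definition L2_inner :: "real \<Rightarrow> real \<Rightarrow> (real \<Rightarrow> real) \<Rightarrow> (real \<Rightarrow> real) \<Rightarrow> real" where
  "L2_inner l r f g = (LINT x:{l<..<r}|lebesgue. f x * g x)"

definition test_functions :: "real \<Rightarrow> real \<Rightarrow> (real \<Rightarrow> real) set" where
  "test_functions l r = {\<phi>. (\<forall>k. (deriv ^^ k) \<phi> differentiable_on UNIV) \<and>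
                            closure {x. \<phi> x \<noteq> 0} \<subseteq> {l<..<r}}"

definition is_weak_deriv ::
  "real \<Rightarrow> real \<Rightarrow> (real \<Rightarrow> real) \<Rightarrow> (real \<Rightarrow> real) \<Rightarrow> bool" where
  "is_weak_deriv l r u g \<longleftrightarrow>
     (\<forall>\<phi> \<in> test_functions l r. L2_inner l r u (deriv \<phi>) = - L2_inner l r g \<phi>)"

(* Elements of H1 are given by their continuous representative on the closed interval, so
   that point values, including boundary values, make sense. *)
definition H1 :: "real \<Rightarrow> real \<Rightarrow> (real \<Rightarrow> real) set" where
  "H1 l r = {u. continuous_on {l..r} u \<and> u \<in> L2 l r \<and> (\<exists>g \<in> L2 l r. is_weak_deriv l r u g)}"

definition H10 :: "real \<Rightarrow> real \<Rightarrow> (real \<Rightarrow> real) set" where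
  "H10 l r = {u \<in> H1 l r. u l = 0 \<and> u r = 0}"

(* The weak derivative is unique only almost everywhere; integrals do not depend on the
   choice.  Meaningful for u in H1 l r only. *)
definition wderiv :: "real \<Rightarrow> real \<Rightarrow> (real \<Rightarrow> real) \<Rightarrow> real \<Rightarrow> real" where
  "wderiv l r u = (SOME g. g \<in> L2 l r \<and> is_weak_deriv l r u g)"

definition bform ::
  "real \<Rightarrow> real \<Rightarrow> real \<Rightarrow> real \<Rightarrow> real \<Rightarrow> (real \<Rightarrow> real) \<Rightarrow> (real \<Rightarrow> real) \<Rightarrow> real" where
  "bform \<epsilon> b c l r u v =
     \<epsilon> * L2_inner l r (wderiv l r u) (wderiv l r v) + b * L2_inner l r u (wderiv l r v)
       + c * L2_inner l r u v"

(* Weak solution of -\<epsilon> u'' - b u' + c u = f on [l, r] with u(l) = \<alpha>, u(r) = \<beta>. *)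
definition weak_solution ::
  "real \<Rightarrow> real \<Rightarrow> real \<Rightarrow> (real \<Rightarrow> real) \<Rightarrow> real \<Rightarrow> real \<Rightarrow> real \<Rightarrow> real \<Rightarrow> (real \<Rightarrow> real) \<Rightarrow> bool" where
  "weak_solution \<epsilon> b c f l r \<alpha> \<beta> u \<longleftrightarrow>
     u \<in> H1 l r \<and> u l = \<alpha> \<and> u r = \<beta> \<and>
     (\<forall>v \<in> H10 l r. bform \<epsilon> b c l r u v = L2_inner l r f v)"

(* A grid of [l, r] is represented by its finite set of nodes, including l and r. *)
definition fe_space :: "real \<Rightarrow> real \<Rightarrow> real set \<Rightarrow> (real \<Rightarrow> real) set" where
  "fe_space l r T = {v. continuous_on {l..r} v \<and>
     (\<forall>p \<in> T. \<forall>q \<in> T. p < q \<and> T \<inter> {p<..<q} = {} \<longrightarrow>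
        (\<exists>m k. \<forall>x \<in> {p..q}. v x = m * x + k))}"

definition is_nodal_basis :: "real \<Rightarrow> real \<Rightarrow> real set \<Rightarrow> real \<Rightarrow> (real \<Rightarrow> real) \<Rightarrow> bool" where
  "is_nodal_basis l r T p \<phi> \<longleftrightarrow>
     \<phi> \<in> fe_space l r T \<and> \<phi> p = 1 \<and> (\<forall>q \<in> T - {p}. \<phi> q = 0)"

definition fe_solution ::
  "real \<Rightarrow> real \<Rightarrow> real \<Rightarrow> (real \<Rightarrow> real) \<Rightarrow> real \<Rightarrow> real \<Rightarrow> real set \<Rightarrow> real \<Rightarrow> real
     \<Rightarrow> (real \<Rightarrow> real) \<Rightarrow> bool" where
  "fe_solution \<epsilon> b c f l r T \<alpha> \<beta> U \<longleftrightarrow>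
     U \<in> fe_space l r T \<and> U l = \<alpha> \<and> U r = \<beta> \<and>
     (\<forall>v \<in> fe_space l r T. v l = 0 \<and> v r = 0 \<longrightarrow> bform \<epsilon> b c l r U v = L2_inner l r f v)"

end

theory Submission
  imports Defs
begin

text \<open>
  The bilinear form $a$ is definite on $H^1_0$: for $e$ vanishing at both ends, $(e,e') = 0$, so that
  $a(e,e) = \varepsilon\|e'\|^2 + c\|e\|^2$ is zero only for $e = 0$. Weak solutions and finite element
  solutions with given boundary values are therefore unique, on every interval and every grid. It
  remains to turn $u$ and $\hat u^{n+1}$ into solutions of the two problems on the shorter interval.

  For the weak solutions this is locality: a test function on $[0,\hat s_1]$ extended by zero is a test
  function on $[0,1]$, so the restriction of $u$ solves the problem that defines $w$
  (\<open>weak_solution_restrict_unique\<close>).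

  The restriction of $\hat u^{n+1}$ solves the discrete equations on $[0,\hat s_1]$ for the same reason, but in
  general it has the wrong value at $\hat s_1$. Adding a multiple of $\varphi_{\hat s_1}$ repairs the value, and
  changes nothing on $[0,x_n]$. The discrete equations survive: of all basis functions of the
  truncated grid that vanish at $0$ and $\hat s_1$, only the one at $x_n$ overlaps $\varphi_{\hat s_1}$, and the node
  $\hat s_1$ was placed such that $a(\varphi_{\hat s_1},\widetilde\varphi_n) = 0$ (\<open>fe_solution_truncate\<close>).

  The analytic groundwork is the description of $H^1$ of an interval as the primitives of $L^2$
  functions. One direction is integration by parts, obtained from Fubini
  (\<open>integration_by_parts_primitive_on\<close>); the other is the lemma of du Bois-Reymond, which rests on smooth
  bump functions (\<open>du_bois_reymond\<close>, \<open>smooth_bump_exists\<close>). That weak derivatives are unique up to null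
  sets (\<open>L2_inner_primitive_on_unique\<close>) makes $a$ independent of the derivatives chosen, and extension by
  zero then becomes a statement about primitives (\<open>bform_zero_extension\<close>).
\<close>

section \<open>Smooth functions and bumps\<close>

definition smooth :: "(real \<Rightarrow> real) \<Rightarrow> bool" where
  "smooth f \<longleftrightarrow> (\<forall>k. (deriv ^^ k) f differentiable_on UNIV)"

text \<open>
  All iterated derivatives stay in a class that is closed under differentiation, so exhibiting such
  a class replaces every computation of higher derivatives.
\<close>

lemma smooth_coinduct:
  assumes "f \<in> C"
    and C: "\<And>f. f \<in> C \<Longrightarrow> \<exists>f' \<in> C. \<forall>x. (f has_real_derivative f' x) (at x)"
  shows "smooth f"
proof -
  have "(deriv ^^ k) f \<in> C" for k
  proof (induction k)
    case (Suc k)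
    then obtain f' where f': "f' \<in> C" "\<And>x. ((deriv ^^ k) f has_real_derivative f' x) (at x)"
      using C by blast
    then have "deriv ((deriv ^^ k) f) = f'"
      by (intro ext DERIV_imp_deriv)
    with f' show ?case by simp
  qed (use assms in simp)
  then have "(deriv ^^ k) f differentiable (at x)" for k x
    using C[of "(deriv ^^ k) f"] by (auto simp: real_differentiable_def)
  then show ?thesis
    by (simp add: smooth_def differentiable_on_def)
qed

lemma smooth_deriv:
  assumes "smooth f"
  shows "smooth (deriv f)" "(f has_real_derivative deriv f x) (at x)"
proof -
  show "smooth (deriv f)"
    unfolding smooth_def
  proof
    fix k show "(deriv ^^ k) (deriv f) differentiable_on UNIV"
      using assms[unfolded smooth_def, rule_format, of "Suc k"] by (simp add: funpow_swap1)
  qed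
  have "f differentiable at x"
    using assms[unfolded smooth_def, rule_format, of 0] by (simp add: differentiable_on_def)
  then show "(f has_real_derivative deriv f x) (at x)"
    by (simp add: DERIV_deriv_iff_real_differentiable)
qed

lemma smooth_imp_continuous_on: "smooth f \<Longrightarrow> continuous_on A f"
  by (meson DERIV_isCont continuous_at_imp_continuous_on smooth_deriv(2))

lemma smooth_linear_combination:
  assumes "smooth f" "smooth g"
  shows "smooth (\<lambda>x. \<alpha> * f x + \<beta> * g x)"
proof (rule smooth_coinduct)
  let ?C = "{\<lambda>x. \<alpha> * f x + \<beta> * g x | f g. smooth f \<and> smooth g}"
  show "(\<lambda>x. \<alpha> * f x + \<beta> * g x) \<in> ?C" using assms by blast
  fix h assume "h \<in> ?C"
  then obtain f g where h: "h = (\<lambda>x. \<alpha> * f x + \<beta> * g x)" and "smooth f" "smooth g" by blast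
  then have "(\<lambda>x. \<alpha> * deriv f x + \<beta> * deriv g x) \<in> ?C"
    by (blast intro: smooth_deriv)
  moreover have "(h has_real_derivative \<alpha> * deriv f x + \<beta> * deriv g x) (at x)" for x
    unfolding h by (intro DERIV_add DERIV_cmult smooth_deriv \<open>smooth f\<close> \<open>smooth g\<close>)
  ultimately show "\<exists>h' \<in> ?C. \<forall>x. (h has_real_derivative h' x) (at x)"
    by (intro bexI[where x = "\<lambda>x. \<alpha> * deriv f x + \<beta> * deriv g x"] allI)
qed

lemma smooth_antiderivative:
  assumes "smooth f" "\<And>x. (F has_real_derivative f x) (at x)"
  shows "smooth F"
proof (rule smooth_coinduct[where C = "insert F {f. smooth f}"])
  fix h assume "h \<in> insert F {f. smooth f}"
  then show "\<exists>h' \<in> insert F {f. smooth f}. \<forall>x. (h has_real_derivative h' x) (at x)"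
    using assms smooth_deriv by blast
qed simp

text \<open>
  With $q(x) = (x-a)(b-x)$ this is $p\,q^{-m}e^{-1/q}$ on $(a,b)$, extended by zero. The numerator $p$ and
  the exponent $m$ are there only to make the family closed under differentiation; the actual bump
  is the case $p = 1$, $m = 0$.
\<close>

definition bump_family :: "real poly \<Rightarrow> nat \<Rightarrow> real \<Rightarrow> real \<Rightarrow> real \<Rightarrow> real" where
  "bump_family p m a b x =
     (if a < x \<and> x < b then poly p x * exp (- 1 / ((x - a) * (b - x))) / ((x - a) * (b - x)) ^ m
      else 0)"

lemma exp_ge_power_div_fact:
  assumes "(t::real) \<ge> 0" shows "t ^ k / fact k \<le> exp t"
proof -
  have s: "(\<lambda>n. t ^ n / fact n) sums exp t"
    using exp_converges[of t] by (simp add: divide_inverse mult.commute)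
  have "sum (\<lambda>n. t ^ n / fact n) {k} \<le> (\<Sum>n. t ^ n / fact n)"
    using s assms by (intro sum_le_suminf) (auto simp: sums_iff)
  then show ?thesis using s by (simp add: sums_iff)
qed

text \<open>
  Since $e^{1/q}$ dominates $q^{-(m+2)}$ up to a constant, each member of the family is $O(q^2)$, and $q$ is at
  most $(b-a)$ times the distance to any point outside $(a,b)$. This second-order decay is what makes
  the extension by zero differentiable, with derivative zero, at the end points.
\<close>

lemma bump_family_quadratic_bound:
  assumes "a < b"
  obtains K where "\<And>x0 y. x0 \<le> a \<or> b \<le> x0 \<Longrightarrow> \<bar>bump_family p m a b y\<bar> \<le> K * (y - x0)\<^sup>2"
proof -
  have "bounded ((\<lambda>x. poly p x) ` {a..b})"
    by (intro compact_imp_bounded compact_continuous_image continuous_intros) auto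
  then obtain P where "P > 0" "\<forall>y \<in> (\<lambda>x. poly p x) ` {a..b}. norm y \<le> P"
    by (auto simp: bounded_pos)
  then have P: "\<bar>poly p x\<bar> \<le> P" if "x \<in> {a..b}" for x
    using that by auto
  let ?K = "P * fact (m + 2) * (b - a)\<^sup>2"
  have "\<bar>bump_family p m a b y\<bar> \<le> ?K * (y - x0)\<^sup>2" if x0: "x0 \<le> a \<or> b \<le> x0" for x0 y
  proof (cases "a < y \<and> y < b")
    case True
    define q where "q = (y - a) * (b - y)"
    have q: "q > 0" using True by (simp add: q_def)
    have eq: "bump_family p m a b y = poly p y * (exp (- 1 / q) / q ^ m)"
      using True by (simp add: bump_family_def q_def)
    have q_le: "q \<le> \<bar>y - x0\<bar> * (b - a)"
      using x0
    proof
      assume "x0 \<le> a"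
      then show ?thesis using True unfolding q_def by (intro mult_mono) auto
    next
      assume "b \<le> x0"
      then have "(b - y) * (y - a) \<le> \<bar>y - x0\<bar> * (b - a)"
        using True by (intro mult_mono) auto
      then show ?thesis by (simp add: q_def mult.commute)
    qed
    have "exp (- 1 / q) / q ^ m \<le> fact (m + 2) * q\<^sup>2"
    proof -
      have "(1 / q) ^ (m + 2) / fact (m + 2) \<le> exp (1 / q)"
        using q by (intro exp_ge_power_div_fact) simp
      then have "exp (- 1 / q) * ((1 / q) ^ (m + 2) / fact (m + 2)) \<le> exp (- 1 / q) * exp (1 / q)"
        by (intro mult_left_mono) auto
      also have "\<dots> = 1" by (simp flip: exp_add)
      finally have "exp (- 1 / q) * (1 / q) ^ (m + 2) / fact (m + 2) \<le> 1"
        by (simp only: times_divide_eq_right)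
      then have "exp (- 1 / q) * (1 / q) ^ (m + 2) \<le> fact (m + 2)"
        using fact_gt_zero[of "m + 2", where 'a = real] by (simp only: pos_divide_le_eq mult_1)
      then have "exp (- 1 / q) * (1 / q) ^ (m + 2) * q\<^sup>2 \<le> fact (m + 2) * q\<^sup>2"
        by (intro mult_right_mono) auto
      then show ?thesis
        using q by (simp add: power_add power_divide power2_eq_square field_simps del: fact_Suc)
    qed
    then have "\<bar>poly p y\<bar> * (exp (- 1 / q) / q ^ m) \<le> P * (fact (m + 2) * q\<^sup>2)"
      using P[of y] True q \<open>P > 0\<close> by (intro mult_mono) auto
    also have "\<dots> \<le> P * (fact (m + 2) * (\<bar>y - x0\<bar> * (b - a))\<^sup>2)"
      using q q_le \<open>P > 0\<close> by (intro mult_left_mono power_mono) auto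
    finally show ?thesis
      using q unfolding eq by (simp add: abs_mult power_mult_distrib ac_simps del: fact_Suc)
  next
    case False
    then show ?thesis using \<open>P > 0\<close> by (auto simp: bump_family_def)
  qed
  then show ?thesis by (rule that)
qed

lemma bump_family_derivative:
  assumes "a < b"
  defines "q \<equiv> [:- a, 1:] * [:b, - 1:]"
  shows "(bump_family p m a b has_real_derivative
           bump_family (pderiv p * q\<^sup>2 - of_nat m * p * pderiv q * q + p * pderiv q) (m + 2) a b x) (at x)"
proof (cases "a < x \<and> x < b")
  case True
  have q: "poly q y = (y - a) * (b - y)" for y by (simp add: q_def algebra_simps)
  have pos: "poly q x > 0" using True by (simp add: q)
  have "((\<lambda>y. poly p y * exp (- 1 / poly q y) / poly q y ^ m) has_real_derivative
     poly (pderiv p * q\<^sup>2 - of_nat m * p * pderiv q * q + p * pderiv q) x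
        * exp (- 1 / poly q x) / poly q x ^ (m + 2)) (at x)"
    using pos
    apply -
    apply (rule derivative_eq_intros poly_DERIV refl | simp)+
    apply (cases m)
    apply (simp_all add: power2_eq_square field_simps)
    done
  then show ?thesis
  proof (rule has_field_derivative_transform_within_open[where S = "{a<..<b}", THEN DERIV_cong])
  qed (use True in \<open>auto simp: bump_family_def q\<close>)
next
  case False
  then have x: "x \<le> a \<or> b \<le> x" by auto
  obtain K where K: "\<And>x0 y. x0 \<le> a \<or> b \<le> x0 \<Longrightarrow> \<bar>bump_family p m a b y\<bar> \<le> K * (y - x0)\<^sup>2"
    using bump_family_quadratic_bound[OF assms(1)] by blast
  have "((\<lambda>y. bump_family p m a b y / (y - x)) \<longlongrightarrow> 0) (at x)"
  proof (rule Lim_null_comparison)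
    show "\<forall>\<^sub>F y in at x. norm (bump_family p m a b y / (y - x)) \<le> K * \<bar>y - x\<bar>"
      using K[OF x] by (intro eventually_at_filter[THEN iffD2] always_eventually)
        (auto simp: divide_simps power2_eq_square abs_mult_self_eq ac_simps)
    have "((\<lambda>y. K * \<bar>y - x\<bar>) \<longlongrightarrow> K * \<bar>x - x\<bar>) (at x)" by (intro tendsto_intros)
    then show "((\<lambda>y. K * \<bar>y - x\<bar>) \<longlongrightarrow> 0) (at x)" by simp
  qed
  then show ?thesis
    using False by (auto simp: has_field_derivative_iff bump_family_def)
qed

lemma smooth_bump_family: "a < b \<Longrightarrow> smooth (bump_family p m a b)"
  by (rule smooth_coinduct[where C = "{bump_family p m a b | p m. True}"])
     (use bump_family_derivative in blast)+

text \<open>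
  The antiderivatives of differences of such bumps are the test functions used below.
\<close>

lemma smooth_bump_exists:
  assumes "a < b"
  obtains B where "smooth B" "\<And>x. B x \<ge> 0" "\<And>x. x \<notin> {a<..<b} \<Longrightarrow> B x = 0"
    "(B has_integral 1) {a..b}"
proof -
  let ?B = "bump_family 1 0 a b"
  have sm: "smooth ?B" using assms by (rule smooth_bump_family)
  have nonneg: "?B x \<ge> 0" for x by (simp add: bump_family_def)
  have int: "?B integrable_on {a..b}"
    by (intro integrable_continuous_real smooth_imp_continuous_on sm)
  have "integral {a..b} ?B \<noteq> 0"
  proof
    assume "integral {a..b} ?B = 0"
    then have "(?B has_integral 0) (cbox a b)" using int by (metis box_real(2) integrable_integral)
    then have "?B ((a + b) / 2) = 0"
      using assms nonneg
      by (intro has_integral_0_cbox_imp_0[where a = a and b = b] smooth_imp_continuous_on sm) auto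
    then show False using assms by (simp add: bump_family_def field_simps split: if_splits)
  qed
  moreover have "integral {a..b} ?B \<ge> 0" using nonneg int by (intro integral_nonneg) auto
  ultimately have pos: "integral {a..b} ?B > 0" by simp
  let ?c = "1 / integral {a..b} ?B"
  show thesis
  proof
    show "smooth (\<lambda>x. ?c * ?B x + 0 * ?B x)" by (intro smooth_linear_combination sm)
    show "?c * ?B x + 0 * ?B x \<ge> 0" for x using pos nonneg by simp
    show "x \<notin> {a<..<b} \<Longrightarrow> ?c * ?B x + 0 * ?B x = 0" for x by (auto simp: bump_family_def)
    have "((\<lambda>x. ?c * ?B x) has_integral ?c * integral {a..b} ?B) {a..b}"
      using int by (intro has_integral_mult_right integrable_integral)
    then show "((\<lambda>x. ?c * ?B x + 0 * ?B x) has_integral 1) {a..b}" using pos by simp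
  qed
qed

text \<open>
  The vanishing integral is what makes the antiderivative return to zero on the right, hence have
  compact support.
\<close>

lemma test_function_antiderivative:
  assumes "smooth D" "l < a" "a \<le> b" "b < r"
    and zero: "\<And>x. x \<notin> {a..b} \<Longrightarrow> D x = 0" and int: "(D has_integral 0) {a..b}"
  obtains \<phi> where "\<phi> \<in> test_functions l r" "deriv \<phi> = D"
proof -
  have "\<exists>F. \<forall>x::real. - \<infinity> < ereal x \<longrightarrow> ereal x < \<infinity> \<longrightarrow> (F has_vector_derivative D x) (at x)"
    using assms(1) by (intro einterval_antiderivative)
      (auto intro!: DERIV_isCont smooth_deriv)
  then obtain F where F: "\<And>x. (F has_real_derivative D x) (at x)"
    by (auto simp: has_real_derivative_iff_has_vector_derivative)
  define \<phi> where "\<phi> x = F x - F a" for x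
  have d\<phi>: "(\<phi> has_real_derivative D x) (at x)" for x
    unfolding \<phi>_def by (auto intro!: derivative_eq_intros F)
  have "(D has_integral F b - F a) {a..b}"
    using \<open>a \<le> b\<close> F
    by (intro fundamental_theorem_of_calculus)
       (simp_all add: has_field_derivative_at_within flip: has_real_derivative_iff_has_vector_derivative)
  then have "F b - F a = 0" using int by (rule has_integral_unique)
  then have "F b = F a" by simp
  have const: "F x = F y" if "x \<le> y" and disj: "{x<..<y} \<inter> {a..b} = {}" for x y
  proof (cases "x = y")
    case False
    have "continuous_on {x..y} F"
      using F by (meson DERIV_isCont continuous_at_imp_continuous_on)
    moreover have "(F has_real_derivative 0) (at z)" if z: "x < z" "z < y" for z
    proof -
      have "z \<in> {x<..<y}" using z by simp
      then have "D z = 0" using disj by (intro zero) blast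
      then show ?thesis using F[of z] by simp
    qed
    ultimately show ?thesis
      using DERIV_isconst_end[of x y F] False \<open>x \<le> y\<close> by simp
  qed simp
  have out: "\<phi> x = 0" if "x \<notin> {a..b}" for x
  proof (cases "x < a")
    case True
    then have "{x<..<a} \<inter> {a..b} = {}" by auto
    then show ?thesis using const[of x a] True by (simp add: \<phi>_def)
  next
    case False
    then have "{b<..<x} \<inter> {a..b} = {}" "b \<le> x" using that by auto
    then show ?thesis using const[of b x] \<open>F b = F a\<close> by (simp add: \<phi>_def)
  qed
  show thesis
  proof
    show "deriv \<phi> = D" by (intro ext DERIV_imp_deriv d\<phi>)
    have "closure {x. \<phi> x \<noteq> 0} \<subseteq> {a..b}"
      using out by (intro closure_minimal) (blast, simp)
    then show "\<phi> \<in> test_functions l r"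
      using smooth_antiderivative[OF assms(1) d\<phi>] assms(2,4)
      unfolding test_functions_def smooth_def by fastforce
  qed
qed

section \<open>Square-integrable functions and Fubini on a triangle\<close>

text \<open>
  The product is dominated by the sum of the two squares.
\<close>

lemma L2_mult_integrable:
  assumes "f \<in> L2 l r" "g \<in> L2 l r"
  shows "set_integrable lebesgue {l<..<r} (\<lambda>x. f x * g x)"
proof -
  let ?I = "indicator {l<..<r} :: real \<Rightarrow> real"
  have [measurable]: "(\<lambda>x. ?I x * f x) \<in> borel_measurable lebesgue"
    "(\<lambda>x. ?I x * g x) \<in> borel_measurable lebesgue"
    using assms by (auto simp: L2_def set_borel_measurable_def)
  have "integrable lebesgue (\<lambda>x. ?I x * (f x)\<^sup>2 + ?I x * (g x)\<^sup>2)"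
    using assms by (intro Bochner_Integration.integrable_add) (auto simp: L2_def set_integrable_def)
  then have "integrable lebesgue (\<lambda>x. (?I x * f x) * (?I x * g x))"
  proof (rule Bochner_Integration.integrable_bound)
    have "\<bar>a * b\<bar> \<le> \<bar>a\<^sup>2 + b\<^sup>2\<bar>" for a b :: real
    proof -
      have "2 * (\<bar>a\<bar> * \<bar>b\<bar>) \<le> a\<^sup>2 + b\<^sup>2"
        using sum_squares_bound[of "\<bar>a\<bar>" "\<bar>b\<bar>"] by simp
      moreover have "0 \<le> \<bar>a\<bar> * \<bar>b\<bar>" by simp
      ultimately show ?thesis unfolding abs_mult by linarith
    qed
    then show "AE x in lebesgue. norm (?I x * f x * (?I x * g x)) \<le> norm (?I x * (f x)\<^sup>2 + ?I x * (g x)\<^sup>2)"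
      by (auto split: split_indicator)
  qed measurable
  moreover have "(\<lambda>x. (?I x * f x) * (?I x * g x)) = (\<lambda>x. ?I x *\<^sub>R (f x * g x))"
    by (auto split: split_indicator)
  ultimately show ?thesis by (simp add: set_integrable_def)
qed

lemma L2_continuous:
  assumes "continuous_on {l..r} f"
  shows "f \<in> L2 l r"
proof -
  have i: "h absolutely_integrable_on {l<..<r}" if "continuous_on {l..r} h" for h :: "real \<Rightarrow> real"
    using absolutely_integrable_continuous_real[OF that] 
    by (rule set_integrable_subset) auto
  have "f absolutely_integrable_on {l<..<r}" "(\<lambda>x. (f x)\<^sup>2) absolutely_integrable_on {l<..<r}"
    by (intro i assms continuous_intros)+
  then show ?thesis
    by (auto simp: L2_def set_borel_measurable_def set_integrable_def)
qed

lemma L2_lincomb: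
  assumes "f \<in> L2 l r" "g \<in> L2 l r"
  shows "(\<lambda>x. \<alpha> * f x + \<beta> * g x) \<in> L2 l r"
proof -
  let ?I = "indicator {l<..<r} :: real \<Rightarrow> real"
  have [measurable]: "(\<lambda>x. ?I x *\<^sub>R f x) \<in> borel_measurable lebesgue"
    "(\<lambda>x. ?I x *\<^sub>R g x) \<in> borel_measurable lebesgue"
    using assms by (auto simp: L2_def set_borel_measurable_def)
  have "(\<lambda>x. \<alpha> * (?I x *\<^sub>R f x) + \<beta> * (?I x *\<^sub>R g x)) \<in> borel_measurable lebesgue"
    by measurable
  moreover have "set_integrable lebesgue {l<..<r}
      (\<lambda>x. \<alpha>\<^sup>2 * (f x * f x) + (2 * \<alpha> * \<beta>) * (f x * g x) + \<beta>\<^sup>2 * (g x * g x))"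
    by (intro set_integral_add set_integrable_mult_right L2_mult_integrable assms)
  moreover have "(\<lambda>x. \<alpha> * (?I x *\<^sub>R f x) + \<beta> * (?I x *\<^sub>R g x)) = (\<lambda>x. ?I x *\<^sub>R (\<alpha> * f x + \<beta> * g x))"
    by (auto split: split_indicator)
  moreover have "(\<lambda>x. \<alpha>\<^sup>2 * (f x * f x) + (2 * \<alpha> * \<beta>) * (f x * g x) + \<beta>\<^sup>2 * (g x * g x))
      = (\<lambda>x. (\<alpha> * f x + \<beta> * g x)\<^sup>2)"
    by (intro ext) algebra
  ultimately show ?thesis
    by (simp only: L2_def set_borel_measurable_def mem_Collect_eq)
qed

lemma L2_inner_eq_integral:
  assumes "f \<in> L2 l r" "g \<in> L2 l r"
  shows "(\<lambda>x. f x * g x) absolutely_integrable_on {l..r}"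
    and "L2_inner l r f g = integral {l..r} (\<lambda>x. f x * g x)"
proof -
  note i = L2_mult_integrable[OF assms]
  show "(\<lambda>x. f x * g x) absolutely_integrable_on {l..r}"
    using i absolutely_integrable_on_open_interval[of l r "\<lambda>x. f x * g x"] by simp
  show "L2_inner l r f g = integral {l..r} (\<lambda>x. f x * g x)"
    unfolding L2_inner_def using set_lebesgue_integral_eq_integral(2)[OF i]
    by (simp add: integral_open_interval_real)
qed

lemma L2_absolutely_integrable:
  assumes "f \<in> L2 l r" shows "f absolutely_integrable_on {l..r}"
  using L2_inner_eq_integral(1)[OF assms L2_continuous[of l r "\<lambda>_. 1"]] by simp

lemma L2_integrable_on:
  assumes "f \<in> L2 l r" "t \<le> r" shows "f integrable_on {l..t}"
proof (rule integrable_on_subinterval)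
  show "f integrable_on {l..r}"
    using L2_absolutely_integrable[OF assms(1)] by (rule set_lebesgue_integral_eq_integral(1))
qed (use assms in auto)

lemma L2_inner_commute: "L2_inner l r f g = L2_inner l r g f"
  by (simp add: L2_inner_def mult.commute)

lemma L2_inner_lincomb_left:
  assumes "f \<in> L2 l r" "g \<in> L2 l r" "h \<in> L2 l r"
  shows "L2_inner l r (\<lambda>x. \<alpha> * f x + \<beta> * g x) h = \<alpha> * L2_inner l r f h + \<beta> * L2_inner l r g h"
proof -
  note i = L2_mult_integrable[OF assms(1,3)] L2_mult_integrable[OF assms(2,3)]
  have "(\<lambda>x. (\<alpha> * f x + \<beta> * g x) * h x) = (\<lambda>x. \<alpha> * (f x * h x) + \<beta> * (g x * h x))"
    by (simp add: algebra_simps)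
  then show ?thesis
    unfolding L2_inner_def using i by simp
qed

lemma L2_inner_lincomb_right:
  assumes "f \<in> L2 l r" "g \<in> L2 l r" "h \<in> L2 l r"
  shows "L2_inner l r h (\<lambda>x. \<alpha> * f x + \<beta> * g x) = \<alpha> * L2_inner l r h f + \<beta> * L2_inner l r h g"
  using L2_inner_lincomb_left[OF assms] by (simp add: L2_inner_commute)

text \<open>
  Needed to apply Fubini on the product of two copies of the completed measure.
\<close>

lemma sigma_finite_lebesgue: "sigma_finite_measure (lebesgue :: real measure)"
proof
  have "(\<Union>n. {- real n..real n}) = UNIV"
  proof safe
    fix x :: real
    obtain n where "\<bar>x\<bar> \<le> real n" using real_arch_simple by blast
    then show "x \<in> (\<Union>n. {- real n..real n})" by (auto intro!: exI[of _ n])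
  qed auto
  then show "\<exists>A. countable A \<and> A \<subseteq> sets lebesgue \<and> \<Union> A = space (lebesgue :: real measure) \<and>
      (\<forall>a\<in>A. emeasure lebesgue a \<noteq> \<infinity>)"
    by (intro exI[of _ "range (\<lambda>n. {- real n..real n})"]) auto
qed

text \<open>
  The right-hand side is the integral of $g(x)h(y)$ over a square. Cut the square along its diagonal:
  by Fubini, the part $x \le y$ gives the first summand and the part $y < x$ the second. This is
  integration by parts for primitives of functions that are merely integrable.
\<close>

lemma integral_primitive_product:
  fixes g h :: "real \<Rightarrow> real"
  assumes g: "g absolutely_integrable_on {l..r}" and h: "h absolutely_integrable_on {l..r}"
  shows "integral {l..r} (\<lambda>y. integral {l..y} g * h y) + integral {l..r} (\<lambda>x. g x * integral {l..x} h)
    = integral {l..r} g * integral {l..r} h" (is "?A + ?B = _")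
    and "(\<lambda>y. integral {l..y} g * h y) absolutely_integrable_on {l..r}"
    and "(\<lambda>x. g x * integral {l..x} h) absolutely_integrable_on {l..r}"
proof -
  interpret lebesgue: sigma_finite_measure "lebesgue :: real measure"
    by (rule sigma_finite_lebesgue)
  interpret pair_sigma_finite "lebesgue :: real measure" "lebesgue :: real measure" ..
  define G where "G x = indicator {l..r} x *\<^sub>R g x" for x
  define H where "H x = indicator {l..r} x *\<^sub>R h x" for x
  have G: "integrable lebesgue G" and H: "integrable lebesgue H"
    using g h by (simp_all add: G_def[abs_def] H_def[abs_def] set_integrable_def)
  note [measurable] = borel_measurable_integrable[OF G] borel_measurable_integrable[OF H]
  have [measurable]: "(\<lambda>x. x) \<in> borel_measurable (lebesgue :: real measure)"
    by (rule measurable_completion) simp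
  define K where "K = (\<lambda>(x, y). G x * H y)"
  have K: "integrable (lebesgue \<Otimes>\<^sub>M lebesgue) K"
    unfolding K_def
    by (rule Fubini_integrable) (use G H in \<open>auto simp: abs_mult\<close>)
  \<comment> \<open>The order of the factors anticipates which variable is integrated first.\<close>
  let ?K1 = "\<lambda>(x, y). G x * (if x \<le> y then 1 else 0) * H y"
  let ?K2 = "\<lambda>(x, y). G x * ((if y < x then 1 else 0) * H y)"
  have K1: "integrable (lebesgue \<Otimes>\<^sub>M lebesgue) ?K1"
    by (rule Bochner_Integration.integrable_bound[OF K]) (auto simp: K_def)
  have K2: "integrable (lebesgue \<Otimes>\<^sub>M lebesgue) ?K2"
    by (rule Bochner_Integration.integrable_bound[OF K]) (auto simp: K_def)
  have prim: "(\<integral>x. F x * (if x \<le> y then 1 else 0) \<partial>lebesgue) = integral {l..y} f"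
     "(\<integral>x. (if x < y then 1 else 0) * F x \<partial>lebesgue) = integral {l..y} f"
    if f: "f absolutely_integrable_on {l..r}" and F: "\<And>x. F x = indicator {l..r} x *\<^sub>R f x"
      and y: "y \<in> {l..r}" for f F :: "real \<Rightarrow> real" and y
  proof -
    have i: "f absolutely_integrable_on {l..y}" "f absolutely_integrable_on {l..<y}"
      using y by (auto intro!: set_integrable_subset[OF f])
    have "(\<lambda>x. F x * (if x \<le> y then 1 else 0)) = (\<lambda>x. indicator {l..y} x *\<^sub>R f x)"
      using y by (auto simp: F split: split_indicator)
    then show "(\<integral>x. F x * (if x \<le> y then 1 else 0) \<partial>lebesgue) = integral {l..y} f"
      using set_lebesgue_integral_eq_integral(2)[OF i(1)] by (simp add: set_lebesgue_integral_def)
    have "(\<lambda>x. (if x < y then 1 else 0) * F x) = (\<lambda>x. indicator {l..<y} x *\<^sub>R f x)"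
      using y by (auto simp: F split: split_indicator)
    moreover have "integral {l..<y} f = integral {l..y} f"
      by (rule integral_subset_negligible)
         (auto intro: negligible_subset[OF negligible_sing[of y]])
    ultimately show "(\<integral>x. (if x < y then 1 else 0) * F x \<partial>lebesgue) = integral {l..y} f"
      using set_lebesgue_integral_eq_integral(2)[OF i(2)] by (simp add: set_lebesgue_integral_def)
  qed
  have e1: "(\<lambda>y. \<integral>x. G x * (if x \<le> y then 1 else 0) * H y \<partial>lebesgue)
      = (\<lambda>y. indicator {l..r} y *\<^sub>R (integral {l..y} g * h y))"
  proof
    fix y show "(\<integral>x. G x * (if x \<le> y then 1 else 0) * H y \<partial>lebesgue)
      = indicator {l..r} y *\<^sub>R (integral {l..y} g * h y)"
      using prim(1)[OF g G_def, of y] by (cases "y \<in> {l..r}") (auto simp: H_def)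
  qed
  have e2: "(\<lambda>x. \<integral>y. G x * ((if y < x then 1 else 0) * H y) \<partial>lebesgue)
      = (\<lambda>x. indicator {l..r} x *\<^sub>R (g x * integral {l..x} h))"
  proof
    fix x show "(\<integral>y. G x * ((if y < x then 1 else 0) * H y) \<partial>lebesgue)
      = indicator {l..r} x *\<^sub>R (g x * integral {l..x} h)"
      using prim(2)[OF h H_def, of x] by (cases "x \<in> {l..r}") (auto simp: G_def)
  qed
  show a1: "(\<lambda>y. integral {l..y} g * h y) absolutely_integrable_on {l..r}"
    using integrable_snd[OF K1] unfolding e1 set_integrable_def .
  show a2: "(\<lambda>x. g x * integral {l..x} h) absolutely_integrable_on {l..r}"
    using integrable_fst[OF K2] unfolding e2 set_integrable_def .
  have "integral {l..r} g * integral {l..r} h = (\<integral>x. G x \<partial>lebesgue) * (\<integral>y. H y \<partial>lebesgue)"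
    using set_lebesgue_integral_eq_integral(2)[OF g] set_lebesgue_integral_eq_integral(2)[OF h]
    by (simp add: G_def[abs_def] H_def[abs_def] set_lebesgue_integral_def)
  also have "\<dots> = integral\<^sup>L (lebesgue \<Otimes>\<^sub>M lebesgue) K"
    using integral_fst'[OF K] by (simp add: K_def)
  also have "K = (\<lambda>p. ?K1 p + ?K2 p)"
    by (auto simp: K_def fun_eq_iff)
  also have "integral\<^sup>L (lebesgue \<Otimes>\<^sub>M lebesgue) (\<lambda>p. ?K1 p + ?K2 p)
      = integral\<^sup>L (lebesgue \<Otimes>\<^sub>M lebesgue) ?K1 + integral\<^sup>L (lebesgue \<Otimes>\<^sub>M lebesgue) ?K2"
    by (rule Bochner_Integration.integral_add[OF K1 K2])
  also have "integral\<^sup>L (lebesgue \<Otimes>\<^sub>M lebesgue) ?K1 = ?A"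
    using integral_snd[OF K1] set_lebesgue_integral_eq_integral(2)[OF a1]
    unfolding e1 by (simp add: set_lebesgue_integral_def)
  also have "integral\<^sup>L (lebesgue \<Otimes>\<^sub>M lebesgue) ?K2 = ?B"
    using integral_fst[OF K2] set_lebesgue_integral_eq_integral(2)[OF a2]
    unfolding e2 by (simp add: set_lebesgue_integral_def)
  finally show "?A + ?B = integral {l..r} g * integral {l..r} h" by simp
qed

section \<open>Primitives of square-integrable functions\<close>

text \<open>
  A working substitute for the weak derivative: in one dimension $u \in H^1$ with weak derivative $g$
  means that $u$ is the primitive of an $L^2$ function $g$. Both directions are proved below. Unlike the
  definition by test functions, this form can be cut and glued at interior points.
\<close>

definition primitive_on :: "real \<Rightarrow> real \<Rightarrow> (real \<Rightarrow> real) \<Rightarrow> (real \<Rightarrow> real) \<Rightarrow> bool" where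
  "primitive_on l r u g \<longleftrightarrow> g \<in> L2 l r \<and> (\<forall>t \<in> {l..r}. u t = u l + integral {l..t} g)"

lemma primitive_onD:
  assumes "primitive_on l r u g"
  shows "g \<in> L2 l r" and "t \<in> {l..r} \<Longrightarrow> u t = u l + integral {l..t} g"
  using assms unfolding primitive_on_def by blast+

lemma primitive_on_continuous:
  assumes "primitive_on l r u g" shows "continuous_on {l..r} u"
proof -
  have "g integrable_on {l..r}"
    using primitive_onD(1)[OF assms] by (rule L2_integrable_on) simp
  then have "continuous_on {l..r} (\<lambda>t. u l + integral {l..t} g)"
    by (intro continuous_intros indefinite_integral_continuous_1)
  then show ?thesis
    by (rule continuous_on_eq) (rule primitive_onD(2)[OF assms, symmetric])
qed

lemma primitive_on_L2: "primitive_on l r u g \<Longrightarrow> u \<in> L2 l r"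
  by (intro L2_continuous primitive_on_continuous)

lemma primitive_on_lincomb:
  assumes "primitive_on l r u g" "primitive_on l r v h"
  shows "primitive_on l r (\<lambda>x. \<alpha> * u x + \<beta> * v x) (\<lambda>x. \<alpha> * g x + \<beta> * h x)"
  unfolding primitive_on_def
proof (intro conjI ballI)
  show "(\<lambda>x. \<alpha> * g x + \<beta> * h x) \<in> L2 l r"
    using assms by (intro L2_lincomb primitive_onD(1))
  fix t assume t: "t \<in> {l..r}"
  have "g integrable_on {l..t}" "h integrable_on {l..t}"
    using assms t by (auto intro: L2_integrable_on primitive_onD(1))
  then have i: "integral {l..t} (\<lambda>x. \<alpha> * g x + \<beta> * h x) = \<alpha> * integral {l..t} g + \<beta> * integral {l..t} h"
    by (intro integral_unique has_integral_add has_integral_mult_right integrable_integral)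
  have "u t = u l + integral {l..t} g" "v t = v l + integral {l..t} h"
    using primitive_onD(2)[OF assms(1) t] primitive_onD(2)[OF assms(2) t] .
  then show "\<alpha> * u t + \<beta> * v t = \<alpha> * u l + \<beta> * v l + integral {l..t} (\<lambda>x. \<alpha> * g x + \<beta> * h x)"
    unfolding i by (simp add: algebra_simps)
qed

lemma primitive_on_C1:
  assumes "\<And>x. (u has_real_derivative g x) (at x)" "continuous_on {l..r} g"
  shows "primitive_on l r u g"
  unfolding primitive_on_def
proof (intro conjI ballI)
  fix t assume t: "t \<in> {l..r}"
  then have "(g has_integral u t - u l) {l..t}"
    using assms(1) by (intro fundamental_theorem_of_calculus)
      (simp_all add: has_field_derivative_at_within flip: has_real_derivative_iff_has_vector_derivative)
  then show "u t = u l + integral {l..t} g" by (simp add: integral_unique)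
qed (intro L2_continuous assms)

lemma integration_by_parts_primitive_on:
  assumes u: "primitive_on l r u g" and v: "primitive_on l r v h" and "l \<le> r"
  shows "L2_inner l r u h + L2_inner l r g v = u r * v r - u l * v l"
proof -
  have L2: "g \<in> L2 l r" "h \<in> L2 l r" "u \<in> L2 l r" "v \<in> L2 l r"
    using u v by (auto intro: primitive_on_L2 primitive_onD(1))
  note ag = L2_absolutely_integrable[OF L2(1)] and ah = L2_absolutely_integrable[OF L2(2)]
  note P = integral_primitive_product[OF ag ah]
  note i = set_lebesgue_integral_eq_integral(1)
  have u': "u t = u l + integral {l..t} g" and v': "v t = v l + integral {l..t} h"
    if "t \<in> {l..r}" for t using u v that by (auto intro: primitive_onD(2))
  have "L2_inner l r u h = integral {l..r} (\<lambda>x. u l * h x + integral {l..x} g * h x)"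
    unfolding L2_inner_eq_integral(2)[OF L2(3,2)]
    by (rule integral_cong) (subst u', auto simp: algebra_simps)
  also have "\<dots> = u l * integral {l..r} h + integral {l..r} (\<lambda>x. integral {l..x} g * h x)"
    by (intro integral_unique has_integral_add has_integral_mult_right integrable_integral
        i[OF ah] i[OF P(2)])
  finally have 1: "L2_inner l r u h = \<dots>" .
  have "L2_inner l r g v = integral {l..r} (\<lambda>x. v l * g x + g x * integral {l..x} h)"
    unfolding L2_inner_eq_integral(2)[OF L2(1,4)]
    by (rule integral_cong) (subst v', auto simp: algebra_simps)
  also have "\<dots> = v l * integral {l..r} g + integral {l..r} (\<lambda>x. g x * integral {l..x} h)"
    by (intro integral_unique has_integral_add has_integral_mult_right integrable_integral
        i[OF ag] i[OF P(3)])
  finally have 2: "L2_inner l r g v = \<dots>" .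
  have I: "integral {l..r} g = u r - u l" "integral {l..r} h = v r - v l"
    using u'[of r] v'[of r] \<open>l \<le> r\<close> by simp_all
  have "L2_inner l r u h + L2_inner l r g v
      = u l * (v r - v l) + v l * (u r - u l) + (u r - u l) * (v r - v l)"
    using 1 2 P(1) unfolding I by simp
  then show ?thesis by (simp add: algebra_simps)
qed

section \<open>Weak derivatives are derivatives of primitives\<close>

lemma test_functions_smooth: "\<phi> \<in> test_functions l r \<Longrightarrow> smooth \<phi>"
  by (simp add: test_functions_def smooth_def)

lemma test_functions_zero:
  assumes "\<phi> \<in> test_functions l r" "x \<notin> {l<..<r}" shows "\<phi> x = 0"
  using assms closure_subset[of "{x. \<phi> x \<noteq> 0}"] by (auto simp: test_functions_def)

lemma primitive_on_test_function:
  "\<phi> \<in> test_functions l r \<Longrightarrow> primitive_on l' r' \<phi> (deriv \<phi>)"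
  by (intro primitive_on_C1 smooth_deriv smooth_imp_continuous_on test_functions_smooth)

lemma primitive_on_imp_weak_deriv:
  assumes "primitive_on l r u g" "l \<le> r" shows "is_weak_deriv l r u g"
  unfolding is_weak_deriv_def
proof
  fix \<phi> assume \<phi>: "\<phi> \<in> test_functions l r"
  have "\<phi> l = 0" "\<phi> r = 0" using test_functions_zero[OF \<phi>] by auto
  then show "L2_inner l r u (deriv \<phi>) = - L2_inner l r g \<phi>"
    using integration_by_parts_primitive_on[OF assms(1) primitive_on_test_function[OF \<phi>] assms(2)]
    by simp
qed

text \<open>
  Suppose that $h$ is smaller near $p$ than near $q$. The test function whose derivative is a unit bump
  near $p$ minus a unit bump near $q$ then pairs strictly negatively with $h$, a contradiction.
\<close>

lemma du_bois_reymond: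
  assumes "continuous_on {l..r} h"
    and orth: "\<And>\<phi>. \<phi> \<in> test_functions l r \<Longrightarrow> L2_inner l r h (deriv \<phi>) = 0"
    and t: "t \<in> {l..r}"
  shows "h t = h l"
proof -
  have near: "\<exists>a b. l < a \<and> a < b \<and> b < r \<and> (\<forall>x \<in> {a..b}. \<bar>h x - h p\<bar> \<le> e)"
    if p: "p \<in> {l<..<r}" and e: "e > 0" for p e
  proof -
    have "isCont h p"
      using assms(1) p by (intro continuous_on_interior) auto
    then obtain d where d: "d > 0" "\<And>x. dist x p < d \<Longrightarrow> dist (h x) (h p) < e"
      using e unfolding continuous_at_eps_delta by blast
    define a where "a = max (p - d / 2) ((l + p) / 2)"
    define b where "b = min (p + d / 2) ((p + r) / 2)"
    have "l < a" "a < b" "b < r"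
      using p d(1) by (auto simp: a_def b_def max_def min_def field_simps)
    moreover have "\<bar>h x - h p\<bar> \<le> e" if "x \<in> {a..b}" for x
    proof -
      have "dist x p < d" using that d(1) by (auto simp: a_def b_def dist_real_def)
      then show ?thesis using d(2)[of x] by (simp add: dist_real_def)
    qed
    ultimately show ?thesis by blast
  qed
  have not_less: "\<not> h p < h q" if p: "p \<in> {l<..<r}" and q: "q \<in> {l<..<r}" for p q
  proof
    assume less: "h p < h q"
    \<comment> \<open>A third of the gap: the local averages at p and at q still differ by at least e.\<close>
    define e where "e = (h q - h p) / 3"
    have "e > 0" using less by (simp add: e_def)
    obtain a1 b1 where 1: "l < a1" "a1 < b1" "b1 < r" "\<And>x. x \<in> {a1..b1} \<Longrightarrow> \<bar>h x - h p\<bar> \<le> e"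
      using near[OF p \<open>e > 0\<close>] by blast
    obtain a2 b2 where 2: "l < a2" "a2 < b2" "b2 < r" "\<And>x. x \<in> {a2..b2} \<Longrightarrow> \<bar>h x - h q\<bar> \<le> e"
      using near[OF q \<open>e > 0\<close>] by blast
    obtain B1 where B1: "smooth B1" "\<And>x. B1 x \<ge> 0" "\<And>x. x \<notin> {a1<..<b1} \<Longrightarrow> B1 x = 0"
        "(B1 has_integral 1) {a1..b1}"
      using smooth_bump_exists[OF 1(2)] by blast
    obtain B2 where B2: "smooth B2" "\<And>x. B2 x \<ge> 0" "\<And>x. x \<notin> {a2<..<b2} \<Longrightarrow> B2 x = 0"
        "(B2 has_integral 1) {a2..b2}"
      using smooth_bump_exists[OF 2(2)] by blast
    let ?D = "\<lambda>x. 1 * B1 x + (-1) * B2 x"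
    let ?a = "min a1 a2" and ?b = "max b1 b2"
    have I1: "(B1 has_integral 1) {c..d}" if "c \<le> a1" "b1 \<le> d" for c d
      by (rule has_integral_on_superset[OF B1(4)]) (use that B1(3) in auto)
    have I2: "(B2 has_integral 1) {c..d}" if "c \<le> a2" "b2 \<le> d" for c d
      by (rule has_integral_on_superset[OF B2(4)]) (use that B2(3) in auto)
    have "(?D has_integral 1 * 1 + (-1) * 1) {?a..?b}"
      by (intro has_integral_add has_integral_mult_right I1 I2) auto
    then have "(?D has_integral 0) {?a..?b}" by simp
    moreover have "smooth ?D" by (intro smooth_linear_combination B1 B2)
    moreover have "?D x = 0" if "x \<notin> {?a..?b}" for x
    proof -
      have "x \<notin> {a1<..<b1}" "x \<notin> {a2<..<b2}" using that by auto
      then show ?thesis using B1(3) B2(3) by simp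
    qed
    moreover have "l < ?a" "?a \<le> ?b" "?b < r" using 1 2 by auto
    ultimately obtain \<phi> where \<phi>: "\<phi> \<in> test_functions l r" "deriv \<phi> = ?D"
      using test_function_antiderivative[of ?D l ?a ?b r] by blast
    have L2: "h \<in> L2 l r" "B1 \<in> L2 l r" "B2 \<in> L2 l r"
      using assms(1) B1(1) B2(1) by (auto intro: L2_continuous smooth_imp_continuous_on)
    have "0 = L2_inner l r h B1 - L2_inner l r h B2"
      using orth[OF \<phi>(1)] L2_inner_lincomb_right[OF L2(2,3,1), of 1 "-1"] unfolding \<phi>(2) by simp
    moreover have "L2_inner l r h B1 \<le> h p + e"
    proof (rule has_integral_le)
      show "((\<lambda>x. h x * B1 x) has_integral L2_inner l r h B1) {l..r}"
        unfolding L2_inner_eq_integral(2)[OF L2(1,2)]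
        by (intro integrable_integral set_lebesgue_integral_eq_integral(1) L2_inner_eq_integral L2)
      show "((\<lambda>x. (h p + e) * B1 x) has_integral (h p + e)) {l..r}"
        using has_integral_mult_right[OF I1[of l r], of "h p + e"] 1 by simp
      fix x
      show "h x * B1 x \<le> (h p + e) * B1 x"
        using B1(2,3)[of x] 1(4)[of x] by (cases "x \<in> {a1<..<b1}") (auto intro!: mult_right_mono)
    qed
    moreover have "h q - e \<le> L2_inner l r h B2"
    proof (rule has_integral_le)
      show "((\<lambda>x. h x * B2 x) has_integral L2_inner l r h B2) {l..r}"
        unfolding L2_inner_eq_integral(2)[OF L2(1,3)]
        by (intro integrable_integral set_lebesgue_integral_eq_integral(1) L2_inner_eq_integral L2)
      show "((\<lambda>x. (h q - e) * B2 x) has_integral (h q - e)) {l..r}"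
        using has_integral_mult_right[OF I2[of l r], of "h q - e"] 2 by simp
      fix x
      show "(h q - e) * B2 x \<le> h x * B2 x"
        using B2(2,3)[of x] 2(4)[of x] by (cases "x \<in> {a2<..<b2}") (auto intro!: mult_right_mono)
    qed
    ultimately show False using \<open>e > 0\<close> by (simp add: e_def field_simps)
  qed
  show ?thesis
  proof (cases "l < r")
    case True
    then have m: "(l + r) / 2 \<in> {l<..<r}" by auto
    have const: "h x = h ((l + r) / 2)" if "x \<in> closure {l<..<r}" for x
    proof (rule continuous_constant_on_closure[OF _ _ that])
      show "continuous_on (closure {l<..<r}) h" using True assms(1) by simp
      show "h y = h ((l + r) / 2)" if "y \<in> {l<..<r}" for y
        using not_less[OF that m] not_less[OF m that] by simp
    qed
    have "t \<in> closure {l<..<r}" "l \<in> closure {l<..<r}" using True t by auto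
    then show ?thesis by (metis const)
  next
    case False
    then have "t = l" using t by simp
    then show ?thesis by simp
  qed
qed

text \<open>
  By integration by parts, $\int_l^t g$ also has the weak derivative $g$, so its difference to $u$ has weak
  derivative zero and is constant.
\<close>

lemma weak_deriv_imp_primitive_on:
  assumes "continuous_on {l..r} u" "g \<in> L2 l r" "is_weak_deriv l r u g" "l \<le> r"
  shows "primitive_on l r u g"
proof -
  let ?G = "\<lambda>t. integral {l..t} g"
  have G: "primitive_on l r ?G g" using assms(2) by (simp add: primitive_on_def)
  let ?h = "\<lambda>t. 1 * u t + (-1) * ?G t"
  have "?h t = ?h l" if "t \<in> {l..r}" for t
  proof (rule du_bois_reymond[OF _ _ that])
    show "continuous_on {l..r} ?h"
      using assms(1) primitive_on_continuous[OF G] by (intro continuous_intros)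
    fix \<phi> assume \<phi>: "\<phi> \<in> test_functions l r"
    have "L2_inner l r u (deriv \<phi>) = L2_inner l r ?G (deriv \<phi>)"
      using \<phi> assms(3) primitive_on_imp_weak_deriv[OF G assms(4)] by (simp add: is_weak_deriv_def)
    moreover have "deriv \<phi> \<in> L2 l r"
      using primitive_on_test_function[OF \<phi>] by (rule primitive_onD)
    ultimately show "L2_inner l r ?h (deriv \<phi>) = 0"
      using L2_inner_lincomb_left[OF L2_continuous[OF assms(1)] primitive_on_L2[OF G], of "deriv \<phi>" 1 "-1"]
      by simp
  qed
  then have "u t = u l + ?G t" if "t \<in> {l..r}" for t
    using that by fastforce
  then show ?thesis using assms(2) unfolding primitive_on_def by blast
qed

text \<open>
  Two derivatives of the same function have the same integrals over all subintervals. By Lebesgue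
  differentiation they agree almost everywhere, so inner products cannot distinguish them.
\<close>

lemma L2_inner_primitive_on_unique:
  assumes g: "primitive_on l r u g" and g': "primitive_on l r u g'" and k: "k \<in> L2 l r"
  shows "L2_inner l r g k = L2_inner l r g' k"
proof -
  note L2 = primitive_onD(1)[OF g] primitive_onD(1)[OF g']
  define d where "d x = (if x \<in> {l..r} then 1 * g x + (-1) * g' x else 0)" for x
  have P: "primitive_on l r (\<lambda>x. 1 * u x + (-1) * u x) (\<lambda>x. 1 * g x + (-1) * g' x)"
    by (rule primitive_on_lincomb[OF g g'])
  have int: "(\<lambda>x. 1 * g x + (-1) * g' x) integrable_on {l..r}"
    by (rule L2_integrable_on[OF primitive_onD(1)[OF P]]) simp
  have "d integrable_on UNIV"
    unfolding d_def[abs_def] using int by (simp only: integrable_restrict_UNIV)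
  then have d_int: "d integrable_on cbox a b" for a b
    by (rule integrable_on_subcbox) simp
  have zero: "integral {p..q} d = 0" if "l \<le> p" "p \<le> q" "q \<le> r" for p q
  proof -
    have 0: "integral {l..t} d = 0" if "t \<in> {l..r}" for t
    proof -
      have "integral {l..t} d = integral {l..t} (\<lambda>x. 1 * g x + (-1) * g' x)"
        by (rule integral_cong) (use that in \<open>auto simp: d_def\<close>)
      then show ?thesis using primitive_onD(2)[OF P that] by simp
    qed
    have "integral {l..p} d + integral {p..q} d = integral {l..q} d"
      using that d_int[of l q] by (intro Henstock_Kurzweil_Integration.integral_combine) auto
    then show ?thesis using 0[of p] 0[of q] that by simp
  qed
  obtain N where "negligible N"
    and N: "\<And>x e. x \<notin> N \<Longrightarrow> 0 < e \<Longrightarrow> \<exists>\<delta>>0. \<forall>h. 0 < h \<and> h < \<delta> \<longrightarrow>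
              norm (integral (cbox x (x + h *\<^sub>R One)) d /\<^sub>R h ^ DIM(real) - d x) < e"
    using integrable_ccontinuous_explicit[OF d_int] by blast
  have eq: "g' x = g x" if x: "x \<in> {l..r} - (N \<union> {r})" for x
  proof (rule ccontr)
    assume "g' x \<noteq> g x"
    then have "0 < \<bar>d x\<bar>" using x by (simp add: d_def)
    then obtain \<delta> where "\<delta> > 0" and \<delta>: "\<And>h. 0 < h \<Longrightarrow> h < \<delta> \<Longrightarrow>
        norm (integral (cbox x (x + h *\<^sub>R One)) d /\<^sub>R h ^ DIM(real) - d x) < \<bar>d x\<bar>"
      using N[of x "\<bar>d x\<bar>"] x by auto
    \<comment> \<open>The average over [x, x + h] is zero, but for this small h it is closer to d x than \<bar>d x\<bar>.\<close>
    define h where "h = min (\<delta> / 2) (r - x)"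
    have "0 < h" "h < \<delta>" "x + h \<le> r" using \<open>\<delta> > 0\<close> x by (auto simp: h_def)
    then show False using \<delta>[of h] zero[of x "x + h"] x by simp
  qed
  show ?thesis
    unfolding L2_inner_eq_integral(2)[OF L2(1) k] L2_inner_eq_integral(2)[OF L2(2) k]
    by (rule integral_spike[of "N \<union> {r}"]) (use \<open>negligible N\<close> eq in auto)
qed

section \<open>The bilinear form\<close>

lemma primitive_on_imp_H1:
  assumes "primitive_on l r u g" "l \<le> r" shows "u \<in> H1 l r"
  using primitive_on_continuous[OF assms(1)] primitive_on_L2[OF assms(1)] primitive_onD(1)[OF assms(1)]
    primitive_on_imp_weak_deriv[OF assms]
  unfolding H1_def by blast

lemma primitive_on_wderiv:
  assumes "u \<in> H1 l r" "l \<le> r" shows "primitive_on l r u (wderiv l r u)"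
proof -
  have "\<exists>g. g \<in> L2 l r \<and> is_weak_deriv l r u g" using assms(1) unfolding H1_def by blast
  then have "wderiv l r u \<in> L2 l r \<and> is_weak_deriv l r u (wderiv l r u)"
    unfolding wderiv_def by (rule someI_ex)
  moreover have "continuous_on {l..r} u" using assms(1) unfolding H1_def by blast
  ultimately show ?thesis using assms(2) by (blast intro: weak_deriv_imp_primitive_on)
qed

text \<open>
  Frees the bilinear form from the choice operator in \<^const>\<open>wderiv\<close>: any derivative may be used.
\<close>

lemma bform_eq:
  assumes u: "primitive_on l r u g" and v: "primitive_on l r v h" and "l \<le> r"
  shows "bform \<epsilon> b c l r u v
    = \<epsilon> * L2_inner l r g h + b * L2_inner l r u h + c * L2_inner l r u v"
proof -
  have u': "primitive_on l r u (wderiv l r u)" and v': "primitive_on l r v (wderiv l r v)"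
    using assms by (auto intro: primitive_on_wderiv primitive_on_imp_H1)
  have "L2_inner l r (wderiv l r u) (wderiv l r v) = L2_inner l r g (wderiv l r v)"
    by (rule L2_inner_primitive_on_unique[OF u' u primitive_onD(1)[OF v']])
  moreover have "L2_inner l r k (wderiv l r v) = L2_inner l r k h" if "k \<in> L2 l r" for k
    using L2_inner_primitive_on_unique[OF v' v that] by (simp add: L2_inner_commute)
  ultimately show ?thesis
    using primitive_onD(1)[OF u] primitive_on_L2[OF u] by (simp add: bform_def)
qed

lemma H1_lincomb:
  assumes "u \<in> H1 l r" "v \<in> H1 l r" "l \<le> r"
  shows "(\<lambda>x. \<alpha> * u x + \<beta> * v x) \<in> H1 l r"
  using assms by (blast intro: primitive_on_imp_H1 primitive_on_lincomb primitive_on_wderiv)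

lemma bform_lincomb_left:
  assumes "u \<in> H1 l r" "v \<in> H1 l r" "w \<in> H1 l r" "l \<le> r"
  shows "bform \<epsilon> b c l r (\<lambda>x. \<alpha> * u x + \<beta> * v x) w
    = \<alpha> * bform \<epsilon> b c l r u w + \<beta> * bform \<epsilon> b c l r v w"
proof -
  have u: "primitive_on l r u (wderiv l r u)" and v: "primitive_on l r v (wderiv l r v)"
    and w: "primitive_on l r w (wderiv l r w)"
    using assms by (auto intro: primitive_on_wderiv)
  note L = L2_inner_lincomb_left
  show ?thesis
    unfolding bform_eq[OF primitive_on_lincomb[OF u v] w assms(4)]
      bform_eq[OF u w assms(4)] bform_eq[OF v w assms(4)]
    using L[OF u[THEN primitive_onD(1)] v[THEN primitive_onD(1)] w[THEN primitive_onD(1)], of \<alpha> \<beta>]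
      L[OF u[THEN primitive_on_L2] v[THEN primitive_on_L2] w[THEN primitive_onD(1)], of \<alpha> \<beta>]
      L[OF u[THEN primitive_on_L2] v[THEN primitive_on_L2] w[THEN primitive_on_L2], of \<alpha> \<beta>]
    by (simp add: algebra_simps)
qed

lemma bform_lincomb_right:
  assumes "u \<in> H1 l r" "v \<in> H1 l r" "w \<in> H1 l r" "l \<le> r"
  shows "bform \<epsilon> b c l r w (\<lambda>x. \<alpha> * u x + \<beta> * v x)
    = \<alpha> * bform \<epsilon> b c l r w u + \<beta> * bform \<epsilon> b c l r w v"
proof -
  have u: "primitive_on l r u (wderiv l r u)" and v: "primitive_on l r v (wderiv l r v)"
    and w: "primitive_on l r w (wderiv l r w)"
    using assms by (auto intro: primitive_on_wderiv)
  note L = L2_inner_lincomb_right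
  show ?thesis
    unfolding bform_eq[OF w primitive_on_lincomb[OF u v] assms(4)]
      bform_eq[OF w u assms(4)] bform_eq[OF w v assms(4)]
    using L[OF u[THEN primitive_onD(1)] v[THEN primitive_onD(1)] w[THEN primitive_onD(1)], of \<alpha> \<beta>]
      L[OF u[THEN primitive_onD(1)] v[THEN primitive_onD(1)] w[THEN primitive_on_L2], of \<alpha> \<beta>]
      L[OF u[THEN primitive_on_L2] v[THEN primitive_on_L2] w[THEN primitive_on_L2], of \<alpha> \<beta>]
    by (simp add: algebra_simps)
qed

lemma L2_inner_self_nonneg: "0 \<le> L2_inner l r f f"
  unfolding L2_inner_def set_lebesgue_integral_def
  by (intro Bochner_Integration.integral_nonneg) (auto simp: indicator_def)

lemma L2_inner_self_eq_0:
  assumes "f \<in> L2 l r" "L2_inner l r f f = 0" "t \<le> r"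
  shows "integral {l..t} f = 0"
proof -
  have "AE x in lebesgue. indicator {l<..<r} x *\<^sub>R (f x * f x) = 0"
    using assms(2) L2_mult_integrable[OF assms(1,1)]
    unfolding L2_inner_def set_lebesgue_integral_def set_integrable_def
    by (subst (asm) integral_nonneg_eq_0_iff_AE) (auto simp: indicator_def)
  then obtain N where N: "N \<in> null_sets lebesgue"
      "{x. indicator {l<..<r} x *\<^sub>R (f x * f x) \<noteq> 0} \<subseteq> N"
    by (auto elim!: AE_E3 simp: eventually_ae_filter)
  have "integral {l..t} f = integral {l..t} (\<lambda>_. 0)"
  proof (rule integral_spike)
    show "negligible (N \<union> {l, r})" using N(1) by (simp add: negligible_iff_null_sets)
    fix x assume x: "x \<in> {l..t} - (N \<union> {l, r})"
    then have "x \<in> {l<..<r}" using assms(3) by auto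
    moreover have "indicator {l<..<r} x *\<^sub>R (f x * f x) = 0" using x N(2) by blast
    ultimately show "0 = f x" by simp
  qed
  then show ?thesis by simp
qed

text \<open>
  Definiteness of the bilinear form. The convection term $b(e,e')$ is the increment of $b e^2/2$ and
  vanishes by the boundary values, so only $\varepsilon\|e'\|^2 + c\|e\|^2$ remains.
\<close>

lemma H10_eq_0_if_bform_eq_0:
  assumes "e \<in> H10 l r" "bform \<epsilon> b c l r e e = 0" "\<epsilon> > 0" "c \<ge> 0" "l \<le> r" "t \<in> {l..r}"
  shows "e t = 0"
proof -
  define g where "g = wderiv l r e"
  have g: "primitive_on l r e g" and bd: "e l = 0" "e r = 0"
    using assms by (auto simp: H10_def g_def intro: primitive_on_wderiv)
  have "L2_inner l r e g = 0"
    using integration_by_parts_primitive_on[OF g g assms(5)] bd by (simp add: L2_inner_commute)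
  then have "\<epsilon> * L2_inner l r g g + c * L2_inner l r e e = 0"
    using assms(2) unfolding bform_eq[OF g g assms(5)] by simp
  moreover have "0 \<le> \<epsilon> * L2_inner l r g g" "0 \<le> c * L2_inner l r e e"
    using L2_inner_self_nonneg assms(3,4) by auto
  ultimately have "\<epsilon> * L2_inner l r g g = 0" by linarith
  then have "L2_inner l r g g = 0" using assms(3) by simp
  then show ?thesis
    using L2_inner_self_eq_0[OF primitive_onD(1)[OF g], of t] primitive_onD(2)[OF g assms(6)] bd assms(6)
    by simp
qed

section \<open>Restriction and extension by zero\<close>

lemma L2_subinterval:
  assumes "f \<in> L2 l r" "s \<le> r" shows "f \<in> L2 l s"
proof -
  have sub: "{l<..<s} \<subseteq> {l<..<r}" using assms(2) by auto
  have "set_borel_measurable lebesgue {l<..<s} f"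
    using assms(1) sub unfolding L2_def by (auto intro: set_borel_measurable_subset)
  moreover have "set_integrable lebesgue {l<..<s} (\<lambda>x. (f x)\<^sup>2)"
    using assms(1) sub unfolding L2_def by (auto intro: set_integrable_subset)
  ultimately show ?thesis by (simp add: L2_def)
qed

lemma primitive_on_subinterval:
  assumes "primitive_on l r u g" "s \<le> r" shows "primitive_on l s u g"
  using L2_subinterval[OF primitive_onD(1)[OF assms(1)] assms(2)] primitive_onD(2)[OF assms(1)] assms(2)
  unfolding primitive_on_def by (meson atLeastAtMost_iff order_trans)

lemma H1_subinterval: "u \<in> H1 l r \<Longrightarrow> l \<le> s \<Longrightarrow> s \<le> r \<Longrightarrow> u \<in> H1 l s"
  by (meson order_trans primitive_on_imp_H1 primitive_on_subinterval primitive_on_wderiv)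

lemma zero_extension_indicator:
  fixes k v w :: "real \<Rightarrow> real"
  assumes "s \<le> r" "\<And>x. x \<in> {l<..<s} \<Longrightarrow> w x = v x" "\<And>x. x \<in> {s..<r} \<Longrightarrow> w x = 0"
  shows "indicator {l<..<r} x * w x = indicator {l<..<s} x * v x"
  using assms by (cases "x < s") (auto simp: indicator_def)

lemma L2_inner_zero_extension:
  assumes "s \<le> r" "\<And>x. x \<in> {l<..<s} \<Longrightarrow> w x = v x" "\<And>x. x \<in> {s..<r} \<Longrightarrow> w x = 0"
  shows "L2_inner l r k w = L2_inner l s k v"
proof -
  have "indicator {l<..<r} x *\<^sub>R (k x * w x) = indicator {l<..<s} x *\<^sub>R (k x * v x)" for x
    using zero_extension_indicator[of s r l w v x, OF assms] by (simp add: mult.left_commute)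
  then show ?thesis unfolding L2_inner_def set_lebesgue_integral_def by (simp only:)
qed

lemma L2_zero_extension:
  assumes "v \<in> L2 l s" "s \<le> r"
    "\<And>x. x \<in> {l<..<s} \<Longrightarrow> w x = v x" "\<And>x. x \<in> {s..<r} \<Longrightarrow> w x = 0"
  shows "w \<in> L2 l r"
proof -
  have z: "indicator {l<..<r} x * w x = indicator {l<..<s} x * v x" for x
    by (rule zero_extension_indicator[OF assms(2-4)])
  moreover have "indicator {l<..<r} x * (w x)\<^sup>2 = indicator {l<..<s} x * (v x)\<^sup>2" for x
    by (rule zero_extension_indicator) (use assms(2-4) in auto)
  ultimately show ?thesis
    using assms(1) by (simp add: L2_def set_borel_measurable_def set_integrable_def)
qed

text \<open>
  The hypotheses force $v(s) = 0$, so the primitive of the truncated derivative stays constant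
  equal to zero beyond $s$.
\<close>

lemma primitive_on_zero_extension:
  assumes v: "primitive_on l s v h" and "l \<le> s" "s \<le> r"
    and w: "\<And>x. x \<in> {l..s} \<Longrightarrow> w x = v x" "\<And>x. x \<in> {s..r} \<Longrightarrow> w x = 0"
  shows "primitive_on l r w (\<lambda>x. if x < s then h x else 0)" (is "primitive_on l r w ?h")
proof -
  have L2: "?h \<in> L2 l r"
    by (rule L2_zero_extension[OF primitive_onD(1)[OF v] \<open>s \<le> r\<close>]) auto
  have left: "integral {l..t} ?h = integral {l..t} h" if "t \<in> {l..s}" for t
    by (rule integral_spike[of "{s}"]) (use that in auto)
  have "w t = w l + integral {l..t} ?h" if t: "t \<in> {l..r}" for t
  proof (cases "t \<le> s")
    case True
    then show ?thesis
      using left[of t] w(1)[of t] w(1)[of l] primitive_onD(2)[OF v, of t] t \<open>l \<le> s\<close> by simp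
  next
    case False
    have "integral {l..s} ?h + integral {s..t} ?h = integral {l..t} ?h"
      using L2_integrable_on[OF L2, of t] False t \<open>l \<le> s\<close>
      by (intro Henstock_Kurzweil_Integration.integral_combine) auto
    moreover have "integral {s..t} ?h = integral {s..t} (\<lambda>_. 0)"
      by (rule integral_cong) auto
    ultimately have "integral {l..t} ?h = integral {l..s} h"
      using left[of s] \<open>l \<le> s\<close> by simp
    also have "\<dots> = v s - v l"
      using primitive_onD(2)[OF v, of s] \<open>l \<le> s\<close> by simp
    also have "\<dots> = - w l"
      using w(1)[of s] w(2)[of s] w(1)[of l] \<open>l \<le> s\<close> \<open>s \<le> r\<close> by simp
    finally show ?thesis using w(2)[of t] t False by simp
  qed
  then show ?thesis using L2 unfolding primitive_on_def by blast
qed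

text \<open>
  Moves a problem between the whole interval and its left part: tested with an extension by zero, the
  form sees only the left part of $u$.
\<close>

lemma bform_zero_extension:
  assumes u: "u \<in> H1 l r" and v: "v \<in> H1 l s" and "l \<le> s" "s \<le> r"
    and w: "\<And>x. x \<in> {l..s} \<Longrightarrow> w x = v x" "\<And>x. x \<in> {s..r} \<Longrightarrow> w x = 0"
  shows "w \<in> H1 l r" and "bform \<epsilon> b c l r u w = bform \<epsilon> b c l s u v"
proof -
  have "l \<le> r" using assms(3,4) by simp
  let ?h = "\<lambda>x. if x < s then wderiv l s v x else 0"
  have pv: "primitive_on l s v (wderiv l s v)" by (rule primitive_on_wderiv[OF v \<open>l \<le> s\<close>])
  have pw: "primitive_on l r w ?h" by (rule primitive_on_zero_extension[OF pv assms(3,4) w])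
  have pu: "primitive_on l r u (wderiv l r u)" by (rule primitive_on_wderiv[OF u \<open>l \<le> r\<close>])
  show "w \<in> H1 l r" by (rule primitive_on_imp_H1[OF pw \<open>l \<le> r\<close>])
  have "L2_inner l r k ?h = L2_inner l s k (wderiv l s v)" "L2_inner l r k w = L2_inner l s k v" for k
    using \<open>s \<le> r\<close> w by (auto intro!: L2_inner_zero_extension)
  then show "bform \<epsilon> b c l r u w = bform \<epsilon> b c l s u v"
    unfolding bform_eq[OF pu pw \<open>l \<le> r\<close>]
      bform_eq[OF primitive_on_subinterval[OF pu \<open>s \<le> r\<close>] pv \<open>l \<le> s\<close>] by simp
qed

text \<open>
  $v$ is the extension by zero of its restriction to the left part, where $u$ vanishes together with one of
  its derivatives.
\<close>

lemma bform_disjoint_supports: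
  assumes "u \<in> H1 l r" "v \<in> H1 l r" "l \<le> m" "m \<le> r"
    and "\<And>x. x \<in> {l..m} \<Longrightarrow> u x = 0" "\<And>x. x \<in> {m..r} \<Longrightarrow> v x = 0"
  shows "bform \<epsilon> b c l r u v = 0"
proof -
  have v: "v \<in> H1 l m" by (rule H1_subinterval[OF assms(2-4)])
  have zero: "(\<lambda>_. 0) \<in> L2 l m" by (intro L2_continuous continuous_intros)
  have pu: "primitive_on l m u (\<lambda>_. 0)"
    unfolding primitive_on_def using zero assms(3,5) by simp
  have u0: "L2_inner l m u k = 0" for k
  proof -
    have "indicator {l<..<m} x *\<^sub>R (u x * k x) = 0" for x
      using assms(5)[of x] by (auto simp: indicator_def)
    then show ?thesis unfolding L2_inner_def set_lebesgue_integral_def by (simp only: Bochner_Integration.integral_zero)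
  qed
  have "bform \<epsilon> b c l r u v = bform \<epsilon> b c l m u v"
    by (rule bform_zero_extension(2)[OF assms(1) v assms(3,4) refl assms(6)])
  also have "\<dots> = 0"
    unfolding bform_eq[OF pu primitive_on_wderiv[OF v assms(3)] assms(3)]
    by (simp add: u0) (simp add: L2_inner_def)
  finally show ?thesis .
qed

section \<open>Uniqueness and restriction of weak solutions\<close>

text \<open>
  Test functions on the left part extend by zero to test functions on the whole interval. Hence $u$
  itself solves the problem on the left part, and definiteness leaves no second solution.
\<close>

lemma weak_solution_restrict_unique:
  assumes "\<epsilon> > 0" "c \<ge> 0" "l \<le> s" "s \<le> r"
    and u: "weak_solution \<epsilon> b c f l r (u l) \<beta> u"
    and w: "weak_solution \<epsilon> b c f l s (u l) (u s) w"
    and t: "t \<in> {l..s}"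
  shows "w t = u t"
proof -
  let ?e = "\<lambda>x. 1 * w x + (-1) * u x"
  let ?e' = "\<lambda>x. if x < s then ?e x else 0"
  have H: "u \<in> H1 l r" "u \<in> H1 l s" "w \<in> H1 l s"
    using u w assms(3,4) by (auto simp: weak_solution_def intro: H1_subinterval)
  have bd: "w l = u l" "w s = u s" using w by (auto simp: weak_solution_def)
  have e: "?e \<in> H10 l s"
    unfolding H10_def using H1_lincomb[OF H(3,2) assms(3), of 1 "-1"] bd by simp
  have eq: "?e' x = ?e x" if "x \<in> {l..s}" for x using that bd by auto
  have "?e \<in> H1 l s" using e by (simp add: H10_def)
  note ext = bform_zero_extension[OF H(1) this assms(3,4), of ?e', OF eq]
  have "?e' \<in> H1 l r" by (rule ext(1)) auto
  then have "?e' \<in> H10 l r" using bd assms(3,4) by (auto simp: H10_def)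
  then have "bform \<epsilon> b c l r u ?e' = L2_inner l r f ?e'" using u by (simp add: weak_solution_def)
  also have "\<dots> = L2_inner l s f ?e"
    by (rule L2_inner_zero_extension) (use assms(4) in auto)
  finally have "bform \<epsilon> b c l s u ?e = L2_inner l s f ?e"
    using ext(2)[of \<epsilon> b c] by simp
  moreover have "bform \<epsilon> b c l s w ?e = L2_inner l s f ?e"
    using w e by (simp add: weak_solution_def)
  ultimately have "bform \<epsilon> b c l s ?e ?e = 0"
    using bform_lincomb_left[OF H(3,2) \<open>?e \<in> H1 l s\<close> assms(3), of \<epsilon> b c 1 "-1"] by simp
  then have "?e t = 0"
    by (rule H10_eq_0_if_bform_eq_0[OF e _ assms(1,2,3) t])
  then show ?thesis by simp
qed

section \<open>Piecewise affine functions\<close>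

lemma grid_cell_exists:
  fixes T :: "real set"
  assumes "finite T" "a \<in> T" "b \<in> T" "a < x" "x < b" "x \<notin> T"
  obtains p q where "p \<in> T" "q \<in> T" "a \<le> p" "p < x" "x < q" "q \<le> b" "T \<inter> {p<..<q} = {}"
proof -
  define p where "p = Max {y \<in> T. y < x}"
  define q where "q = Min {y \<in> T. x < y}"
  have fin: "finite {y \<in> T. y < x}" "finite {y \<in> T. x < y}" using assms(1) by auto
  have "p \<in> {y \<in> T. y < x}" unfolding p_def by (rule Max_in[OF fin(1)]) (use assms in auto)
  moreover have "q \<in> {y \<in> T. x < y}" unfolding q_def by (rule Min_in[OF fin(2)]) (use assms in auto)
  moreover have p: "y \<le> p" if "y \<in> T" "y < x" for y
    unfolding p_def by (rule Max_ge[OF fin(1)]) (use that in auto)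
  moreover have q: "q \<le> y" if "y \<in> T" "x < y" for y
    unfolding q_def by (rule Min_le[OF fin(2)]) (use that in auto)
  moreover have "y \<notin> {p<..<q}" if "y \<in> T" for y
    using p[OF that] q[OF that] that assms(6) by (cases y x rule: linorder_cases) auto
  ultimately show thesis using assms by (intro that[of p q]) auto
qed

lemma fe_spaceD:
  assumes "v \<in> fe_space l r T" "p \<in> T" "q \<in> T" "p < q" "T \<inter> {p<..<q} = {}"
  obtains m k where "\<And>x. x \<in> {p..q} \<Longrightarrow> v x = m * x + k"
proof -
  have "\<exists>m k. \<forall>x\<in>{p..q}. v x = m * x + k" using assms unfolding fe_space_def by blast
  then show thesis using that by blast
qed

text \<open>
  An affine function that vanishes at both ends of a cell vanishes on the cell.
\<close>

lemma fe_space_eq_0: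
  assumes v: "v \<in> fe_space l r T" and T: "finite T" "a \<in> T" "b \<in> T"
    and zero: "\<And>y. y \<in> T \<Longrightarrow> a \<le> y \<Longrightarrow> y \<le> b \<Longrightarrow> v y = 0" and x: "x \<in> {a..b}"
  shows "v x = 0"
proof (cases "x \<in> T")
  case False
  then have "a < x" "x < b" using x T by (auto simp: less_le)
  then obtain p q where pq: "p \<in> T" "q \<in> T" "a \<le> p" "p < x" "x < q" "q \<le> b" "T \<inter> {p<..<q} = {}"
    using grid_cell_exists[OF T(1,2,3) _ _ False] by blast
  then obtain m k where mk: "\<And>y. y \<in> {p..q} \<Longrightarrow> v y = m * y + k"
    using fe_spaceD[OF v pq(1,2)] by (metis less_trans)
  have "m * p + k = 0" "m * q + k = 0"
    using mk[of p] mk[of q] zero[of p] zero[of q] pq by auto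
  then have "(m * q + k) - (m * p + k) = 0" by simp
  then have "m * (q - p) = 0" by (simp add: algebra_simps)
  then have "m = 0" using pq by simp
  then show ?thesis using mk[of x] \<open>m * p + k = 0\<close> pq by simp
qed (use zero x in auto)

lemma fe_space_lincomb:
  assumes "u \<in> fe_space l r T" "v \<in> fe_space l r T"
  shows "(\<lambda>x. \<alpha> * u x + \<beta> * v x) \<in> fe_space l r T"
proof -
  have "\<exists>m k. \<forall>x \<in> {p..q}. \<alpha> * u x + \<beta> * v x = m * x + k"
    if pq: "p \<in> T" "q \<in> T" "p < q" "T \<inter> {p<..<q} = {}" for p q
  proof -
    obtain m k where u: "\<And>x. x \<in> {p..q} \<Longrightarrow> u x = m * x + k"
      using fe_spaceD[OF assms(1) pq] by blast
    obtain m' k' where v: "\<And>x. x \<in> {p..q} \<Longrightarrow> v x = m' * x + k'"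
      using fe_spaceD[OF assms(2) pq] by blast
    have "\<forall>x \<in> {p..q}. \<alpha> * u x + \<beta> * v x = (\<alpha> * m + \<beta> * m') * x + (\<alpha> * k + \<beta> * k')"
      by (simp add: u v algebra_simps)
    then show ?thesis by blast
  qed
  moreover have "continuous_on {l..r} (\<lambda>x. \<alpha> * u x + \<beta> * v x)"
    using assms by (intro continuous_intros) (auto simp: fe_space_def)
  ultimately show ?thesis unfolding fe_space_def by blast
qed

lemma fe_space_restrict:
  assumes "v \<in> fe_space l r T" "s \<le> r"
  shows "v \<in> fe_space l s (T \<inter> {..s})"
proof -
  have "continuous_on {l..s} v"
    using assms by (auto simp: fe_space_def intro: continuous_on_subset)
  moreover have "\<exists>m k. \<forall>x \<in> {p..q}. v x = m * x + k"
    if "p \<in> T \<inter> {..s}" "q \<in> T \<inter> {..s}" "p < q" "T \<inter> {..s} \<inter> {p<..<q} = {}" for p q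
  proof -
    have pq: "p \<in> T" "q \<in> T" "p < q" "T \<inter> {p<..<q} = {}" using that by force+
    obtain m k where "\<And>x. x \<in> {p..q} \<Longrightarrow> v x = m * x + k"
      using fe_spaceD[OF assms(1) pq] by blast
    then show ?thesis by blast
  qed
  ultimately show ?thesis unfolding fe_space_def by blast
qed

lemma fe_space_zero_extension:
  assumes v: "v \<in> fe_space l s (T \<inter> {..s})" "v s = 0" and "l \<le> s" "s \<le> r" "s \<in> T"
  shows "(\<lambda>x. if x < s then v x else 0) \<in> fe_space l r T" (is "?w \<in> _")
proof -
  have eq: "?w x = v x" if "x \<le> s" for x using that v(2) by auto
  have "continuous_on ({l..s} \<union> {s..r}) ?w"
  proof (rule continuous_on_closed_Un)
    show "continuous_on {l..s} ?w"
      by (rule continuous_on_eq[where f = v]) (use v(1) eq in \<open>auto simp: fe_space_def\<close>)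
    show "continuous_on {s..r} ?w"
      by (rule continuous_on_eq[where f = "\<lambda>_. 0"]) auto
  qed auto
  moreover have "{l..s} \<union> {s..r} = {l..r}" using assms(3,4) by auto
  moreover have "\<exists>m k. \<forall>x \<in> {p..q}. ?w x = m * x + k"
    if pq: "p \<in> T" "q \<in> T" "p < q" "T \<inter> {p<..<q} = {}" for p q
  proof (cases "q \<le> s")
    case True
    have pq': "p \<in> T \<inter> {..s}" "q \<in> T \<inter> {..s}" "p < q" "T \<inter> {..s} \<inter> {p<..<q} = {}"
      using pq True by auto
    obtain m k where "\<And>x. x \<in> {p..q} \<Longrightarrow> v x = m * x + k"
      using fe_spaceD[OF v(1) pq'] by blast
    then have "\<forall>x \<in> {p..q}. ?w x = m * x + k" using eq True by auto
    then show ?thesis by blast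
  next
    case False
    then have "s \<le> p" using pq \<open>s \<in> T\<close> by force
    then have "\<forall>x \<in> {p..q}. ?w x = 0 * x + 0" by auto
    then show ?thesis by blast
  qed
  ultimately show ?thesis unfolding fe_space_def by simp
qed

text \<open>
  The classical derivative, set to zero at the nodes, takes finitely many values and is therefore in
  $L^2$; a continuous function is the primitive of its derivative even when the latter is missing at
  finitely many points.
\<close>

lemma fe_space_imp_H1:
  assumes v: "v \<in> fe_space l r T" and T: "finite T" "l \<in> T" "r \<in> T" and "l \<le> r"
  shows "v \<in> H1 l r"
proof -
  have cont: "continuous_on {l..r} v" using v by (simp add: fe_space_def)
  define g where "g x = (if x \<in> {l<..<r} - T then deriv v x else 0)" for x
  let ?R = "insert 0 ((\<lambda>(p, q). (v q - v p) / (q - p)) ` (T \<times> T))"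
  have cell: "(v has_real_derivative g x) (at x) \<and> g x \<in> ?R" if x: "x \<in> {l<..<r} - T" for x
  proof -
    have "l < x" "x < r" "x \<notin> T" using x by auto
    then obtain p q where pq: "p \<in> T" "q \<in> T" "p < x" "x < q" "T \<inter> {p<..<q} = {}"
      by (rule grid_cell_exists[OF T])
    then obtain m k where mk: "\<And>y. y \<in> {p..q} \<Longrightarrow> v y = m * y + k"
      using fe_spaceD[OF v pq(1,2)] by (metis less_trans)
    have "((\<lambda>y. m * y + k) has_real_derivative m) (at x)"
      by (auto intro!: derivative_eq_intros)
    then have d: "(v has_real_derivative m) (at x)"
      by (rule has_field_derivative_transform_within_open[where S = "{p<..<q}"])
         (use pq mk in auto)
    then have gx: "g x = m" using x by (simp add: g_def DERIV_imp_deriv)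
    have "v q - v p = m * (q - p)"
      using mk[of p] mk[of q] pq by (simp add: algebra_simps)
    then have "g x = (\<lambda>(p, q). (v q - v p) / (q - p)) (p, q)"
      using gx pq by simp
    then have "g x \<in> ?R" using pq(1,2) by blast
    then show ?thesis using d gx by simp
  qed
  have "finite ?R" using T(1) by simp
  then have "bounded ?R" by (rule finite_imp_bounded)
  then obtain M where "\<forall>y \<in> ?R. norm y \<le> M"
    unfolding bounded_iff by blast
  then have M: "\<bar>g x\<bar> \<le> M" for x
    using cell[of x] by (cases "x \<in> {l<..<r} - T") (auto simp: g_def)
  have int: "(g has_integral v t - v l) {l..t}" if "t \<in> {l..r}" for t
  proof (rule fundamental_theorem_of_calculus_interior_strong[OF T(1)])
    show "continuous_on {l..t} v" using that by (auto intro: continuous_on_subset[OF cont])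
    fix x assume "x \<in> {l<..<t} - T"
    then show "(v has_vector_derivative g x) (at x)"
      using cell[of x] that by (simp flip: has_real_derivative_iff_has_vector_derivative)
  qed (use that in auto)
  have "g integrable_on {l..r}" using int[of r] \<open>l \<le> r\<close> by auto
  then have "g integrable_on UNIV"
    by (rule integrable_on_superset) (auto simp: g_def)
  then have meas: "g \<in> borel_measurable lebesgue"
    using integrable_imp_measurable by fastforce
  have "g \<in> L2 l r"
    unfolding L2_def
  proof safe
    have [measurable]: "{l<..<r} \<in> sets lebesgue" by simp
    note [measurable] = meas
    show "set_borel_measurable lebesgue {l<..<r} g"
      unfolding set_borel_measurable_def by measurable
    have "set_integrable lebesgue {l<..<r} (\<lambda>_. M\<^sup>2)"
      by (rule set_integrable_subset[OF absolutely_integrable_on_const[of "{l..r}"]]) auto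
    then show "set_integrable lebesgue {l<..<r} (\<lambda>x. (g x)\<^sup>2)"
      unfolding set_integrable_def
    proof (rule Bochner_Integration.integrable_bound)
      have "(g x)\<^sup>2 \<le> M\<^sup>2" for x
        using power_mono[OF M[of x], of 2] by simp
      then show "AE x in lebesgue. norm (indicator {l<..<r} x *\<^sub>R (g x)\<^sup>2)
          \<le> norm (indicator {l<..<r} x *\<^sub>R M\<^sup>2)"
        by (auto simp: indicator_def)
    qed measurable
  qed
  then have "primitive_on l r v g"
    unfolding primitive_on_def using integral_unique[OF int] by simp
  then show ?thesis using \<open>l \<le> r\<close> by (rule primitive_on_imp_H1)
qed

section \<open>Uniqueness and truncation of finite element solutions\<close>

lemma fe_solutionD:
  assumes "fe_solution \<epsilon> b c f l r T \<alpha> \<beta> U" "v \<in> fe_space l r T" "v l = 0" "v r = 0"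
  shows "bform \<epsilon> b c l r U v = L2_inner l r f v"
  using assms by (simp add: fe_solution_def)

lemma fe_solution_unique:
  assumes "\<epsilon> > 0" "c \<ge> 0" "finite T" "l \<in> T" "r \<in> T" "l \<le> r"
    and U: "fe_solution \<epsilon> b c f l r T \<alpha> \<beta> U" and V: "fe_solution \<epsilon> b c f l r T \<alpha> \<beta> V"
    and t: "t \<in> {l..r}"
  shows "U t = V t"
proof -
  let ?e = "\<lambda>x. 1 * U x + (-1) * V x"
  have fe: "U \<in> fe_space l r T" "V \<in> fe_space l r T" using U V by (auto simp: fe_solution_def)
  note H = fe[THEN fe_space_imp_H1, OF assms(3-6)]
  have e: "?e \<in> fe_space l r T" "?e l = 0" "?e r = 0"
    using U V by (simp_all only: fe_space_lincomb[OF fe]) (simp_all add: fe_solution_def)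
  have eH: "?e \<in> H1 l r" by (rule H1_lincomb[OF H assms(6)])
  have "bform \<epsilon> b c l r U ?e = L2_inner l r f ?e" "bform \<epsilon> b c l r V ?e = L2_inner l r f ?e"
    by (rule fe_solutionD[OF U e], rule fe_solutionD[OF V e])
  then have "bform \<epsilon> b c l r ?e ?e = 0"
    unfolding bform_lincomb_left[OF H eH assms(6)] by simp
  moreover have "?e \<in> H10 l r" using eH e by (simp add: H10_def)
  ultimately have "?e t = 0"
    using H10_eq_0_if_bform_eq_0 assms(1,2,6) t by blast
  then show ?thesis by simp
qed

text \<open>
  The finite element counterpart of restriction, where \<open>p\<close> and \<open>s\<close> are adjacent nodes. Set
  $z = U + (\beta - U(s))\varphi_s$. It has the boundary value $\beta$ at \<open>s\<close> and coincides with $U$ up to \<open>p\<close>. The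
  correction is invisible to every test function $v$ supported in $[l,s]$: the difference
  $v - v(p)\varphi_p$ vanishes to the right of \<open>p\<close>, where $\varphi_s$ lives, and $\varphi_p$ is
  orthogonal to $\varphi_s$ by hypothesis. So $z$ solves the truncated discrete problem and equals $W$.
\<close>

lemma fe_solution_truncate:
  assumes "\<epsilon> > 0" "c \<ge> 0" and T: "finite T" "l \<in> T" "r \<in> T" "p \<in> T" "s \<in> T" "T \<subseteq> {l..r}"
    and "p < s" and adjacent: "T \<inter> {p<..<s} = {}"
    and \<phi>p: "is_nodal_basis l r T p \<phi>p" and \<phi>s: "is_nodal_basis l r T s \<phi>s"
    and orth: "bform \<epsilon> b c l r \<phi>s \<phi>p = 0" and "s < r"
    and U: "fe_solution \<epsilon> b c f l r T \<alpha> 0 U"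
    and W: "fe_solution \<epsilon> b c f l s (T \<inter> {..s}) \<alpha> \<beta> W"
    and t: "t \<in> {l..p}"
  shows "U t = W t"
proof -
  have ord: "l \<le> p" "l < s" "l \<le> s" "s \<le> r" "p \<le> r" "l \<le> r"
    using T \<open>p < s\<close> \<open>s < r\<close> by auto
  have fe: "U \<in> fe_space l r T" "\<phi>p \<in> fe_space l r T" "\<phi>s \<in> fe_space l r T"
    using U \<phi>p \<phi>s by (auto simp: fe_solution_def is_nodal_basis_def)
  note H1 = fe_space_imp_H1[OF _ T(1-3) ord(6)]
  have \<phi>s_at: "\<phi>s s = 1" "\<And>q. q \<in> T \<Longrightarrow> q \<noteq> s \<Longrightarrow> \<phi>s q = 0"
    and \<phi>p_at: "\<phi>p p = 1" "\<And>q. q \<in> T \<Longrightarrow> q \<noteq> p \<Longrightarrow> \<phi>p q = 0"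
    using \<phi>p \<phi>s by (auto simp: is_nodal_basis_def)
  have \<phi>s_left: "\<phi>s x = 0" if "x \<in> {l..p}" for x
    by (rule fe_space_eq_0[OF fe(3) T(1,2,4) _ that]) (use \<phi>s_at(2) \<open>p < s\<close> in auto)
  define z where "z x = 1 * U x + (\<beta> - U s) * \<phi>s x" for x
  have z_fe: "z \<in> fe_space l r T"
    unfolding z_def[abs_def] by (rule fe_space_lincomb[OF fe(1,3)])
  have z: "fe_solution \<epsilon> b c f l s (T \<inter> {..s}) \<alpha> \<beta> z"
    unfolding fe_solution_def
  proof (intro conjI ballI impI)
    show "z \<in> fe_space l s (T \<inter> {..s})" by (rule fe_space_restrict[OF z_fe ord(4)])
    show "z l = \<alpha>" using U \<phi>s_at(2)[of l] T(2) ord by (simp add: z_def fe_solution_def)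
    show "z s = \<beta>" using \<phi>s_at(1) by (simp add: z_def)
    fix v assume v: "v \<in> fe_space l s (T \<inter> {..s})" and bd: "v l = 0 \<and> v s = 0"
    let ?v = "\<lambda>x. if x < s then v x else 0"
    have eq: "?v x = v x" if "x \<in> {l..s}" for x using that bd by auto
    have v_fe: "?v \<in> fe_space l r T"
      using fe_space_zero_extension[OF v] bd ord T(5) by blast
    have vH: "v \<in> H1 l s"
      by (rule fe_space_imp_H1[OF v]) (use T ord in auto)
    \<comment> \<open>Subtracting a multiple of \<phi>p costs nothing by orthogonality, and confines the test function to the left of p.\<close>
    let ?rest = "\<lambda>x. 1 * ?v x + (- v p) * \<phi>p x"
    have rest_fe: "?rest \<in> fe_space l r T" by (rule fe_space_lincomb[OF v_fe fe(2)])
    have "?rest y = 0" if "y \<in> T" "p \<le> y" "y \<le> r" for y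
    proof (cases "y = p")
      case False
      then have "s \<le> y" using that adjacent by force
      then show ?thesis using \<phi>p_at(2)[OF that(1) False] by simp
    qed (use \<phi>p_at \<open>p < s\<close> in simp)
    then have "?rest x = 0" if "x \<in> {p..r}" for x
      using fe_space_eq_0[OF rest_fe T(1,4,3) _ that] by blast
    then have "bform \<epsilon> b c l r \<phi>s ?rest = 0"
      by (intro bform_disjoint_supports[OF H1[OF fe(3)] H1[OF rest_fe] ord(1,5)] \<phi>s_left)
    then have \<phi>s_v: "bform \<epsilon> b c l r \<phi>s ?v = 0"
      using bform_lincomb_right[OF H1[OF v_fe] H1[OF fe(2)] H1[OF fe(3)] ord(6), of \<epsilon> b c 1 "- v p"] orth
      by simp
    have "bform \<epsilon> b c l s z v = bform \<epsilon> b c l r z ?v"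
      by (rule bform_zero_extension(2)[OF H1[OF z_fe] vH ord(3,4) eq, symmetric]) auto
    also have "\<dots> = bform \<epsilon> b c l r U ?v"
      using bform_lincomb_left[OF H1[OF fe(1)] H1[OF fe(3)] H1[OF v_fe] ord(6), of \<epsilon> b c 1 "\<beta> - U s"] \<phi>s_v
      unfolding z_def[abs_def] by simp
    also have "\<dots> = L2_inner l r f ?v"
      by (rule fe_solutionD[OF U v_fe]) (use bd \<open>l < s\<close> \<open>s < r\<close> in auto)
    also have "\<dots> = L2_inner l s f v"
      by (rule L2_inner_zero_extension) (use ord in auto)
    finally show "bform \<epsilon> b c l s z v = L2_inner l s f v" .
  qed
  have "z t = W t"
    by (rule fe_solution_unique[OF assms(1,2) _ _ _ ord(3) z W]) (use T ord t \<open>p < s\<close> in auto)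
  then show ?thesis using \<phi>s_left[OF t] by (simp add: z_def)
qed

theorem theorem4p3:
  fixes \<epsilon> b c s :: real and n :: nat and x :: "nat \<Rightarrow> real" and That :: "real set"
    and f u w uh wn \<phi>n \<phi>s :: "real \<Rightarrow> real"
  assumes "\<epsilon> > 0" and "b \<le> 0" and "c \<ge> 0" and "\<not> (b = 0 \<and> c = 0)"
    and "f \<in> L2 0 1"
    and "n \<ge> 2"
    and "x 0 = 0" and "x (n + 1) = 1" and "\<forall>i \<le> n. x i < x (i + 1)"
    and "x n < s" and "s < 1"
    and "That = insert s (x ` {0..n + 1})"
    and "is_nodal_basis 0 1 That (x n) \<phi>n"
    and "is_nodal_basis 0 1 That s \<phi>s"
    and "bform \<epsilon> b c 0 1 \<phi>s \<phi>n = 0"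
    and "weak_solution \<epsilon> b c f 0 1 0 0 u"
    and "fe_solution \<epsilon> b c f 0 1 That 0 0 uh"
    and "weak_solution \<epsilon> b c f 0 s 0 (u s) w"
    and "fe_solution \<epsilon> b c f 0 s (That - {1}) 0 (u s) wn"
  shows "(\<forall>t \<in> {0..s}. w t = u t) \<and> (\<forall>t \<in> {0..x n}. uh t = wn t)"
proof (intro conjI ballI)
  have mono: "x i \<le> x j" if "i \<le> j" "j \<le> n + 1" for i j
    using that
  proof (induction j rule: dec_induct)
    case (step j)
    then show ?case using assms(9)[rule_format, of j] by simp
  qed simp
  have nodes: "That = insert 1 (insert s (x ` {0..n}))"
    using assms(8,12) by (auto simp: atLeastAtMostSuc_conv)
  have low: "0 \<le> x i \<and> x i \<le> x n" if "i \<le> n" for i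
    using mono[of 0 i] mono[of i n] that assms(7) by simp
  have "0 \<le> x n" using low[of n] by simp
  then have "0 \<le> s" using assms(10) by simp
  have "u 0 = 0" using assms(16) by (simp add: weak_solution_def)
  show "w t = u t" if "t \<in> {0..s}" for t
    by (rule weak_solution_restrict_unique[OF assms(1,3) \<open>0 \<le> s\<close>, where r = 1 and \<beta> = 0])
       (use assms(11,16,18) \<open>u 0 = 0\<close> that in auto)
  have trunc: "That - {1} = That \<inter> {..s}"
    using low assms(10,11) unfolding nodes by force
  show "uh t = wn t" if t: "t \<in> {0..x n}" for t
  proof (rule fe_solution_truncate[OF assms(1,3) _ _ _ _ _ _ assms(10) _ assms(13-15,11,17) _ t])
    show "fe_solution \<epsilon> b c f 0 s (That \<inter> {..s}) 0 (u s) wn"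
      using assms(19) unfolding trunc .
    show "That \<subseteq> {0..1}" "That \<inter> {x n<..<s} = {}"
      using low \<open>0 \<le> s\<close> assms(10,11) unfolding nodes by force+
    show "0 \<in> That" using assms(7) unfolding nodes by force
  qed (auto simp: nodes)
qed

end
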